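(* Let $F$ be a probability distribution on $\mathbb{R}$ with bounded support. For $m\ge1$, let $v_\infty^{1,m}$ be the limit value of the percolation Markov decision process (PMDP) on $\mathbb{Z}$ with action set $\{1,m\}$ and payoff distribution $F$, and let $v_\infty^{(2)}$ be the limit value of the PMDP on $\mathbb{Z}^2$ with action set $\{e_1,e_2\}$, where $e_1=(1,0)$, $e_2=(0,1)$, and payoff distribution $F$. Then $$\lim_{m\to\infty}v_\infty^{1,m}=v_\infty^{(2)}.$$
   Context: A PMDP on $\mathbb{Z}^d$ is a tuple $(I,\mathcal{E},g)$ where $I\subset\mathbb{Z}^d$ is a non-empty finite set (the action set), $\mathcal{E}=(\Omega,\mathscr{F},\mathbb{P})$ is a probability space, and $g=\{\omega\mapsto g_\omega(z,i)\}_{(z,i)\in\mathbb{Z}^d\times I}$ is a collection of uniformly bounded, i.i.d. real-valued random variables on $\Omega$; their common law is the payoff distribution. Let $\mathcal{F}_{\mathrm{all}}=\sigma(\{\omega\mapsto g_\omega(z,i): z\in\mathbb{Z}^d,i\in I\})$. A strategy is a sequence $\sigma=(\sigma_m)_{m\ge1}$ of mappings $\sigma_m:\Omega\times\mathbb{Z}^d\to I$, each measurable with respect to $\mathcal{F}_{\mathrm{all}}\otimes\mathcal{P}(\mathbb{Z}^d)$; $\Sigma$ is the set of strategies. Given an initial state $z$ and $\omega$, $\sigma$ induces the play $z_1=z$, $i_m=\sigma_m(\omega,z)$, $z_{m+1}=z_m+i_m$ for $m\ge1$. The $n$-stage payoff is $\gamma_n^\omega(z,\sigma)=\frac1n\sum_{m=1}^n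 g_\omega(z_m,i_m)$ and the $n$-stage value is $v_n^\omega(z)=\max_{\sigma\in\Sigma}\gamma_n^\omega(z,\sigma)$. The PMDP is oriented if $0\notin\operatorname{conv}(I)$ (as are all the PMDPs in the claim). For oriented PMDPs it is known (Garnier–Ziliotto) that $v_n(z)$ converges $\mathbb{P}$-a.s. as $n\to\infty$ to a deterministic constant independent of $z$, called the limit value. *)

theory Defs
  imports "HOL-Probability.Probability"
begin

text \<open>The lattice \<open>\<int>\<^sup>d\<close> is the type \<open>int ^ 'd\<close>. A PMDP is given by its action set \<open>I\<close>, its
  probability space \<open>M\<close> and its payoffs \<open>g\<close>; the payoff \<open>g \<omega> z i\<close> is only relevant for \<open>i \<in> I\<close>.\<close>

locale pmdp = prob_space M
  for I :: "(int ^ 'd) set"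
    and M :: "'a measure"
    and g :: "'a \<Rightarrow> int ^ 'd \<Rightarrow> int ^ 'd \<Rightarrow> real" +
  assumes finite_actions: "finite I"
    and nonempty_actions: "I \<noteq> {}"
    and bounded_payoffs:
      "\<exists>B. \<forall>\<omega>\<in>space M. \<forall>z. \<forall>i\<in>I. \<bar>g \<omega> z i\<bar> \<le> B"
    and indep_payoffs:
      "indep_vars (\<lambda>_. borel) (\<lambda>(z, i) \<omega>. g \<omega> z i) (UNIV \<times> I)"
    and ident_distr_payoffs:
      "\<And>z z' i i'. i \<in> I \<Longrightarrow> i' \<in> I \<Longrightarrow>
         distr M borel (\<lambda>\<omega>. g \<omega> z i) = distr M borel (\<lambda>\<omega>. g \<omega> z' i')"

definition has_payoff_distribution ::
  "(int ^ 'd) set \<Rightarrow> 'a measure \<Rightarrow> ('a \<Rightarrow> int ^ 'd \<Rightarrow> int ^ 'd \<Rightarrow> real) \<Rightarrow> real measure \<Rightarrow> bool"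
  where "has_payoff_distribution I M g F \<longleftrightarrow>
    (\<forall>z. \<forall>i\<in>I. distr M borel (\<lambda>\<omega>. g \<omega> z i) = F)"

definition payoff_algebra ::
  "(int ^ 'd) set \<Rightarrow> 'a measure \<Rightarrow> ('a \<Rightarrow> int ^ 'd \<Rightarrow> int ^ 'd \<Rightarrow> real) \<Rightarrow> 'a measure"
  where "payoff_algebra I M g =
    sigma (space M)
      {(\<lambda>\<omega>. g \<omega> z i) -` B \<inter> space M | z i B. i \<in> I \<and> B \<in> sets (borel :: real measure)}"

text \<open>Stages are numbered from 1, so the value of a strategy at index 0 is irrelevant. The second
  argument of \<open>\<sigma> m\<close> is the initial state of the play, not its current state.\<close>

definition strategies ::
  "(int ^ 'd) set \<Rightarrow> 'a measure \<Rightarrow> ('a \<Rightarrow> int ^ 'd \<Rightarrow> int ^ 'd \<Rightarrow> real) \<Rightarrow>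
    (nat \<Rightarrow> 'a \<times> (int ^ 'd) \<Rightarrow> int ^ 'd) set"
  where "strategies I M g =
    {\<sigma>. \<forall>m\<ge>1. \<sigma> m \<in> measurable (payoff_algebra I M g \<Otimes>\<^sub>M count_space UNIV) (count_space I)}"

text \<open>The state \<open>z\<^sub>m\<close> of the play at stage \<open>m \<ge> 1\<close> (the value at \<open>m = 0\<close> is a dummy).\<close>

primrec play_state ::
  "(nat \<Rightarrow> 'a \<times> (int ^ 'd) \<Rightarrow> int ^ 'd) \<Rightarrow> 'a \<Rightarrow> int ^ 'd \<Rightarrow> nat \<Rightarrow> int ^ 'd"
  where
    "play_state \<sigma> \<omega> z 0 = z"
  | "play_state \<sigma> \<omega> z (Suc m) =
      (if m = 0 then z else play_state \<sigma> \<omega> z m + \<sigma> m (\<omega>, z))"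

definition stage_payoff ::
  "('a \<Rightarrow> int ^ 'd \<Rightarrow> int ^ 'd \<Rightarrow> real) \<Rightarrow> nat \<Rightarrow> 'a \<Rightarrow> int ^ 'd \<Rightarrow>
    (nat \<Rightarrow> 'a \<times> (int ^ 'd) \<Rightarrow> int ^ 'd) \<Rightarrow> real"
  where "stage_payoff g n \<omega> z \<sigma> =
    (1 / real n) * (\<Sum>m = 1..n. g \<omega> (play_state \<sigma> \<omega> z m) (\<sigma> m (\<omega>, z)))"

definition stage_value ::
  "(int ^ 'd) set \<Rightarrow> 'a measure \<Rightarrow> ('a \<Rightarrow> int ^ 'd \<Rightarrow> int ^ 'd \<Rightarrow> real) \<Rightarrow>
    nat \<Rightarrow> 'a \<Rightarrow> int ^ 'd \<Rightarrow> real"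
  where "stage_value I M g n \<omega> z = Max (stage_payoff g n \<omega> z ` strategies I M g)"

definition is_limit_value ::
  "(int ^ 'd) set \<Rightarrow> 'a measure \<Rightarrow> ('a \<Rightarrow> int ^ 'd \<Rightarrow> int ^ 'd \<Rightarrow> real) \<Rightarrow> real \<Rightarrow> bool"
  where "is_limit_value I M g v \<longleftrightarrow>
    (\<forall>z. AE \<omega> in M. (\<lambda>n. stage_value I M g n \<omega> z) \<longlonglongrightarrow> v)"

definition limit_value ::
  "(int ^ 'd) set \<Rightarrow> 'a measure \<Rightarrow> ('a \<Rightarrow> int ^ 'd \<Rightarrow> int ^ 'd \<Rightarrow> real) \<Rightarrow> real"
  where "limit_value I M g = (THE v. is_limit_value I M g v)"

text \<open>The topological support of a Borel measure on the line.\<close>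

definition measure_support :: "real measure \<Rightarrow> real set"
  where "measure_support F = {x. \<forall>U. open U \<longrightarrow> x \<in> U \<longrightarrow> emeasure F U > 0}"

text \<open>The maximum defining \<open>stage_value\<close> is over a finite non-empty set of reals, and a limit value
  is unique when it exists.\<close>

lemma space_payoff_algebra [simp]: "space (payoff_algebra I M g) = space M"
  unfolding payoff_algebra_def by (rule space_measure_of) auto

lemma strategies_nonempty: "I \<noteq> {} \<Longrightarrow> strategies I M g \<noteq> {}"
proof -
  assume "I \<noteq> {}"
  then obtain i where "i \<in> I" by blast
  then have "(\<lambda>_ _. i) \<in> strategies I M g"
    unfolding strategies_def by auto
  then show ?thesis by blast
qed

lemma play_state_cong:
  assumes "\<And>k. 1 \<le> k \<Longrightarrow> k < m \<Longrightarrow> \<sigma> k (\<omega>, z) = \<tau> k (\<omega>, z)"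
  shows "play_state \<sigma> \<omega> z m = play_state \<tau> \<omega> z m"
  using assms by (induction m) auto

lemma finite_stage_payoffs:
  assumes "finite I" "\<omega> \<in> space M"
  shows "finite (stage_payoff g n \<omega> z ` strategies I M g)"
proof (rule finite_subset)
  show "stage_payoff g n \<omega> z ` strategies I M g \<subseteq>
      (\<lambda>h. stage_payoff g n \<omega> z (\<lambda>m _. h m)) ` PiE {1..n} (\<lambda>_. I)"
  proof
    fix x assume "x \<in> stage_payoff g n \<omega> z ` strategies I M g"
    then obtain \<sigma> where s: "\<sigma> \<in> strategies I M g" and x: "x = stage_payoff g n \<omega> z \<sigma>" by blast
    define h where "h = restrict (\<lambda>m. \<sigma> m (\<omega>, z)) {1..n}"
    have "\<sigma> m (\<omega>, z) \<in> I" if "1 \<le> m" for m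
    proof -
      have "\<sigma> m \<in> measurable (payoff_algebra I M g \<Otimes>\<^sub>M count_space UNIV) (count_space I)"
        using s that unfolding strategies_def by blast
      from measurable_space[OF this, of "(\<omega>, z)"] show ?thesis
        using assms(2) by (simp add: space_pair_measure)
    qed
    then have h: "h \<in> PiE {1..n} (\<lambda>_. I)"
      unfolding h_def by auto
    have ps: "play_state \<sigma> \<omega> z m = play_state (\<lambda>m _. h m) \<omega> z m" if "m \<in> {1..n}" for m
      by (rule play_state_cong) (use that in \<open>auto simp: h_def\<close>)
    have "x = stage_payoff g n \<omega> z (\<lambda>m _. h m)"
      unfolding x stage_payoff_def
    proof (intro arg_cong2[where f = "(*)"] refl sum.cong)
      fix m assume "m \<in> {1..n}"
      then show "g \<omega> (play_state \<sigma> \<omega> z m) (\<sigma> m (\<omega>, z)) =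
          g \<omega> (play_state (\<lambda>m _. h m) \<omega> z m) (h m)"
        using ps[of m] by (simp add: h_def)
    qed
    with h show "x \<in> (\<lambda>h. stage_payoff g n \<omega> z (\<lambda>m _. h m)) ` PiE {1..n} (\<lambda>_. I)" by blast
  qed
  show "finite ((\<lambda>h. stage_payoff g n \<omega> z (\<lambda>m _. h m)) ` PiE {1..n} (\<lambda>_. I))"
    using assms(1) by (intro finite_imageI finite_PiE) auto
qed

lemma limit_value_eq:
  assumes "prob_space M" "is_limit_value I M g v"
  shows "limit_value I M g = v"
  unfolding limit_value_def
proof (rule the_equality)
  fix w assume "is_limit_value I M g w"
  then have "AE \<omega> in M. (\<lambda>n. stage_value I M g n \<omega> 0) \<longlonglongrightarrow> w"
    unfolding is_limit_value_def by blast
  moreover have "AE \<omega> in M. (\<lambda>n. stage_value I M g n \<omega> 0) \<longlonglongrightarrow> v"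
    using assms(2) unfolding is_limit_value_def by blast
  ultimately have "AE \<omega> in M. w = v"
    by eventually_elim (rule LIMSEQ_unique)
  then show "w = v" using prob_space.AE_const[OF assms(1)] by simp
qed fact

end

theory Submission
  imports Defs "HOL-Real_Asymp.Real_Asymp"
begin

text \<open>The map \<open>(x, y) \<mapsto> x + m y\<close> carries the planar walk to the linear one, and identifies no two
  edges used during the first \<open>m\<close> stages. Hence for \<open>n \<le> m\<close> the \<open>n\<close>-stage values of the two models
  have the same law, and it suffices that the expected \<open>n\<close>-stage value be close to the limit value,
  uniformly in \<open>m \<ge> n\<close>. Cut a play of \<open>k n\<close> stages into blocks of \<open>n\<close> stages. By bounded differences
  (changing all payoffs collected at one given stage moves a block value by at most \<open>2 B\<close>) the block
  values have fluctuations of order \<open>\<surd>n\<close>. A block has at most \<open>n + 1\<close> endpoints and blocks along a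
  fixed sequence of endpoints use disjoint payoffs, so a union bound over the endpoints shows that the
  expected value of \<open>k n\<close> stages is \<open>k\<close> times that of \<open>n\<close> stages up to \<open>k O(\<surd>n ln n)\<close>, with a constant
  that depends on \<open>B\<close> only. The same estimate with a worse constant holds for \<open>n > m\<close>, and
  yields the existence of the limit values.\<close>

section \<open>Exponential moments and bounded differences\<close>

lemma (in finite_measure) integrable_bounded:
  fixes f :: "'a \<Rightarrow> real"
  assumes "f \<in> borel_measurable M" "\<And>x. x \<in> space M \<Longrightarrow> \<bar>f x\<bar> \<le> C"
  shows "integrable M f"
  by (rule integrable_const_bound[where B = C]) (use assms in auto)

lemma (in finite_measure) integrable_exp_bounded:
  fixes f :: "'a \<Rightarrow> real"
  assumes [measurable]: "f \<in> borel_measurable M" and "\<And>x. x \<in> space M \<Longrightarrow> \<bar>f x\<bar> \<le> C"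
  shows "integrable M (\<lambda>x. exp (t * f x))"
proof (rule integrable_bounded[where C = "exp (\<bar>t\<bar> * C)"])
  fix x assume "x \<in> space M"
  then have "\<bar>t * f x\<bar> \<le> \<bar>t\<bar> * C"
    using assms(2) by (simp add: abs_mult mult_left_mono)
  then show "\<bar>exp (t * f x)\<bar> \<le> exp (\<bar>t\<bar> * C)" by simp
qed simp

lemma (in prob_space) abs_expectation_le:
  fixes f :: "'a \<Rightarrow> real"
  assumes "f \<in> borel_measurable M" "\<And>x. x \<in> space M \<Longrightarrow> \<bar>f x\<bar> \<le> C"
  shows "\<bar>expectation f\<bar> \<le> C"
proof -
  have int: "integrable M f" using assms by (rule integrable_bounded)
  have "expectation f \<le> C"
    by (rule integral_le_const[OF int]) (use assms(2) in fastforce)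
  moreover have "- C \<le> expectation f"
    by (rule integral_ge_const[OF int]) (use assms(2) in fastforce)
  ultimately show ?thesis by simp
qed

lemma (in prob_space) exp_expectation_le:
  fixes f :: "'a \<Rightarrow> real"
  assumes "integrable M f" "integrable M (\<lambda>x. exp (f x))"
  shows "exp (expectation f) \<le> expectation (\<lambda>x. exp (f x))"
  by (rule jensens_inequality[where I = UNIV])
    (use assms convex_on_exp[of 1] in auto)

text \<open>The difference between \<open>X x\<close> and its mean is the average of
  \<open>X x - X y\<close> over \<open>y\<close>, so it is at most \<open>D\<close> in absolute
  value. Hoeffding's lemma for an interval of length \<open>2 * D\<close> then turns
  \<open>(2 * D)\<^sup>2 / 8\<close> into the variance term \<open>D\<^sup>2 / 2\<close>.\<close>

lemma (in prob_space) hoeffding_mgf: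
  fixes X :: "'a \<Rightarrow> real"
  assumes [measurable]: "X \<in> borel_measurable M"
    and osc: "\<And>x y. x \<in> space M \<Longrightarrow> y \<in> space M \<Longrightarrow> \<bar>X x - X y\<bar> \<le> D"
  shows "expectation (\<lambda>x. exp (t * X x)) \<le> exp (t * expectation X + D\<^sup>2 * t\<^sup>2 / 2)"
proof -
  obtain x0 where x0: "x0 \<in> space M" using not_empty by blast
  have bdd: "\<bar>X x\<bar> \<le> D + \<bar>X x0\<bar>" if "x \<in> space M" for x
    using osc[OF that x0] by linarith
  have int: "integrable M X" using bdd by (intro integrable_bounded) auto
  have dev: "\<bar>X x - expectation X\<bar> \<le> D" if x: "x \<in> space M" for x
  proof -
    have "\<bar>expectation (\<lambda>y. X x - X y)\<bar> \<le> D"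
      by (rule abs_expectation_le) (use osc x in auto)
    then show ?thesis using int by (simp add: prob_space)
  qed
  \<comment> \<open>Hoeffding's lemma is applied with a positive parameter; for \<open>t < 0\<close>
    this is used with \<open>- X\<close> and \<open>- t\<close>.\<close>
  have pos: "expectation (\<lambda>x. exp (s * Y x)) \<le> exp (s * expectation Y + D\<^sup>2 * s\<^sup>2 / 2)"
    if s: "s > 0" and [measurable]: "Y \<in> borel_measurable M" and iY: "integrable M Y"
      and dY: "\<And>x. x \<in> space M \<Longrightarrow> \<bar>Y x - expectation Y\<bar> \<le> D"
    for s :: real and Y
  proof -
    interpret Y: interval_bounded_random_variable M Y "expectation Y - D" "expectation Y + D"
    proof unfold_locales
      show "AE x in M. Y x \<in> {expectation Y - D..expectation Y + D}"
        using dY by (intro AE_I2) (auto simp: abs_le_iff algebra_simps)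
    qed simp
    have bY: "\<bar>Y x\<bar> \<le> D + \<bar>expectation Y\<bar>" if "x \<in> space M" for x
      using dY[OF that] by linarith
    have i: "integrable M (\<lambda>x. exp (s * (Y x - expectation Y)))"
    proof (rule integrable_exp_bounded)
      show "\<bar>Y x - expectation Y\<bar> \<le> D" if "x \<in> space M" for x using dY that .
    qed simp
    have "ennreal (expectation (\<lambda>x. exp (s * (Y x - expectation Y))))
        = nn_integral M (\<lambda>x. ennreal (exp (s * (Y x - expectation Y))))"
      using i by (intro nn_integral_eq_integral[symmetric]) auto
    also have "\<dots> \<le> ennreal (exp (s\<^sup>2 * (expectation Y + D - (expectation Y - D))\<^sup>2 / 8))"
      by (rule Y.Hoeffdings_lemma_nn_integral) fact
    also have "(expectation Y + D - (expectation Y - D))\<^sup>2 = 4 * D\<^sup>2"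
      by (simp add: power2_eq_square)
    finally have le: "expectation (\<lambda>x. exp (s * (Y x - expectation Y))) \<le> exp (D\<^sup>2 * s\<^sup>2 / 2)"
      by (simp add: field_simps)
    have "expectation (\<lambda>x. exp (s * Y x))
        = expectation (\<lambda>x. exp (s * expectation Y) * exp (s * (Y x - expectation Y)))"
      by (simp add: exp_add[symmetric] algebra_simps)
    also have "\<dots> = exp (s * expectation Y) * expectation (\<lambda>x. exp (s * (Y x - expectation Y)))"
      by simp
    also have "\<dots> \<le> exp (s * expectation Y) * exp (D\<^sup>2 * s\<^sup>2 / 2)"
      using le by (intro mult_left_mono) auto
    finally show ?thesis by (simp add: exp_add)
  qed
  consider "t > 0" | "t = 0" | "t < 0" by linarith
  then show ?thesis
  proof cases
    case 1
    then show ?thesis using pos[of t X] int dev by simp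
  next
    case 2
    then show ?thesis by (simp add: prob_space)
  next
    case 3
    have "expectation (\<lambda>x. exp ((- t) * (- X x)))
        \<le> exp ((- t) * expectation (\<lambda>x. - X x) + D\<^sup>2 * (- t)\<^sup>2 / 2)"
      by (rule pos[of "- t" "\<lambda>x. - X x"]) (use 3 int dev in \<open>auto simp: abs_minus_commute\<close>)
    then show ?thesis by simp
  qed
qed

text \<open>The coordinates are grouped by a rank, so that only the number \<open>c\<close> of ranks matters.\<close>

lemma bounded_differences_mgf:
  fixes F :: "'b measure" and f :: "('j \<Rightarrow> 'b) \<Rightarrow> real"
  assumes F: "prob_space F" and "finite J"
    and "f \<in> borel_measurable (PiM J (\<lambda>_. F))"
    and "\<And>x. x \<in> space (PiM J (\<lambda>_. F)) \<Longrightarrow> \<bar>f x\<bar> \<le> C"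
    and "\<And>j. j \<in> J \<Longrightarrow> r j < (c::nat)"
    and "\<And>x y k. x \<in> space (PiM J (\<lambda>_. F)) \<Longrightarrow> y \<in> space (PiM J (\<lambda>_. F)) \<Longrightarrow>
      (\<And>j. j \<in> J \<Longrightarrow> r j \<noteq> k \<Longrightarrow> x j = y j) \<Longrightarrow> \<bar>f x - f y\<bar> \<le> D"
  shows "(\<integral>x. exp (t * f x) \<partial>PiM J (\<lambda>_. F))
    \<le> exp (t * (\<integral>x. f x \<partial>PiM J (\<lambda>_. F)) + real c * D\<^sup>2 * t\<^sup>2 / 2)"
  using assms(2-)
proof (induction c arbitrary: J f)
  case 0
  interpret F: prob_space F by fact
  have J: "J = {}" using "0.prems" by auto
  interpret P: prob_space "PiM J (\<lambda>_. F)" by (rule prob_space_PiM) (rule F)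
  let ?u = "\<lambda>_. undefined"
  have sp: "space (PiM J (\<lambda>_. F)) = {?u}" unfolding J by (simp add: space_PiM)
  have c: "(\<integral>x. h x \<partial>PiM J (\<lambda>_. F)) = h ?u" for h :: "('j \<Rightarrow> 'b) \<Rightarrow> real"
  proof -
    have "(\<integral>x. h x \<partial>PiM J (\<lambda>_. F)) = (\<integral>x. h ?u \<partial>PiM J (\<lambda>_. F))"
      by (rule Bochner_Integration.integral_cong) (auto simp: sp)
    then show ?thesis by (simp add: P.prob_space)
  qed
  show ?case by (simp add: c)
next
  case (Suc c)
  interpret F: prob_space F by fact
  interpret PS: product_sigma_finite "\<lambda>_. F" by standard
  \<comment> \<open>The induction removes the group \<open>G\<close> of top rank: with the
    coordinates in \<open>A\<close> fixed, Hoeffding's lemma controls the integral over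
    \<open>G\<close> at the price of one variance term.\<close>
  define A where "A = {j\<in>J. r j < c}"
  define G where "G = {j\<in>J. r j = c}"
  have J: "J = A \<union> G" using Suc.prems(4) unfolding A_def G_def by (auto simp: less_Suc_eq)
  have dis: "A \<inter> G = {}" unfolding A_def G_def by auto
  have fin: "finite A" "finite G" using Suc.prems(1) unfolding A_def G_def by auto
  let ?PA = "PiM A (\<lambda>_. F)" and ?PG = "PiM G (\<lambda>_. F)" and ?PJ = "PiM J (\<lambda>_. F)"
  interpret A: prob_space ?PA by (rule prob_space_PiM) (rule F)
  interpret G: prob_space ?PG by (rule prob_space_PiM) (rule F)
  interpret P: prob_space ?PJ by (rule prob_space_PiM) (rule F)
  note fm[measurable] = Suc.prems(2)
  have mg: "merge A G (x, y) \<in> space ?PJ" if "x \<in> space ?PA" "y \<in> space ?PG" for x y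
    using that unfolding J by (auto simp: space_PiM PiE_iff merge_def extensional_def)
  have mm[measurable]: "(\<lambda>p. f (merge A G p)) \<in> borel_measurable (?PA \<Otimes>\<^sub>M ?PG)"
    using measurable_merge[of A G "\<lambda>_. F"] Suc.prems(2) unfolding J
    by (rule measurable_compose)
  have my[measurable]: "(\<lambda>y. f (merge A G (x, y))) \<in> borel_measurable ?PG" if "x \<in> space ?PA" for x
    using measurable_compose[OF measurable_Pair1'[OF that] mm] .
  \<comment> \<open>\<open>H\<close> is the conditional mean of \<open>f\<close> given the
    coordinates in \<open>A\<close>. Averaging over \<open>G\<close> preserves measurability, the
    bound \<open>C\<close> and the bounded differences, so the induction hypothesis applies to
    \<open>H\<close>.\<close>
  define H where "H x = (\<integral>y. f (merge A G (x, y)) \<partial>?PG)" for x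
  have Hm[measurable]: "H \<in> borel_measurable ?PA"
    unfolding H_def by measurable
  have Hb: "\<bar>H x\<bar> \<le> C" if "x \<in> space ?PA" for x
    unfolding H_def by (rule G.abs_expectation_le) (use that my mg Suc.prems(3) in auto)
  have IH: "(\<integral>x. exp (t * H x) \<partial>?PA) \<le> exp (t * (\<integral>x. H x \<partial>?PA) + real c * D\<^sup>2 * t\<^sup>2 / 2)"
  proof (rule Suc.IH)
    show "finite A" by fact
    show "H \<in> borel_measurable ?PA" by fact
    show "\<bar>H x\<bar> \<le> C" if "x \<in> space ?PA" for x using Hb that .
    show "r j < c" if "j \<in> A" for j using that unfolding A_def by simp
    fix x x' k assume x: "x \<in> space ?PA" and x': "x' \<in> space ?PA"
      and eq: "\<And>j. j \<in> A \<Longrightarrow> r j \<noteq> k \<Longrightarrow> x j = x' j"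
    have ix: "integrable ?PG (\<lambda>y. f (merge A G (x, y)))" if "x \<in> space ?PA" for x
      by (rule G.integrable_bounded[where C = C]) (use that my mg Suc.prems(3) in auto)
    have "H x - H x' = (\<integral>y. f (merge A G (x, y)) - f (merge A G (x', y)) \<partial>?PG)"
      unfolding H_def using ix x x' by simp
    also have "\<bar>\<dots>\<bar> \<le> D"
    proof (rule G.abs_expectation_le)
      show "(\<lambda>y. f (merge A G (x, y)) - f (merge A G (x', y))) \<in> borel_measurable ?PG"
        using my x x' by measurable
      fix y assume y: "y \<in> space ?PG"
      show "\<bar>f (merge A G (x, y)) - f (merge A G (x', y))\<bar> \<le> D"
      proof (rule Suc.prems(5)[OF mg[OF x y] mg[OF x' y]])
        fix j assume "j \<in> J" "r j \<noteq> k"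
        then show "merge A G (x, y) j = merge A G (x', y) j"
          using eq by (auto simp: merge_def)
      qed
    qed
    finally show "\<bar>H x - H x'\<bar> \<le> D" .
  qed
  have inner: "(\<integral>y. exp (t * f (merge A G (x, y))) \<partial>?PG) \<le> exp (t * H x + D\<^sup>2 * t\<^sup>2 / 2)"
    if x: "x \<in> space ?PA" for x
    unfolding H_def
  proof (rule G.hoeffding_mgf)
    show "(\<lambda>y. f (merge A G (x, y))) \<in> borel_measurable ?PG" using my x .
    fix y y' assume y: "y \<in> space ?PG" and y': "y' \<in> space ?PG"
    show "\<bar>f (merge A G (x, y)) - f (merge A G (x, y'))\<bar> \<le> D"
      by (rule Suc.prems(5)[OF mg[OF x y] mg[OF x y'], of c])
        (auto simp: merge_def A_def G_def)
  qed
  have intJ: "integrable ?PJ f" using Suc.prems(2,3) by (rule P.integrable_bounded)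
  have intE: "integrable ?PJ (\<lambda>x. exp (t * f x))" using Suc.prems(2,3) by (rule P.integrable_exp_bounded)
  have m2: "(\<lambda>x. \<integral>y. exp (t * f (merge A G (x, y))) \<partial>?PG) \<in> borel_measurable ?PA"
    by measurable
  have "(\<integral>x. exp (t * f x) \<partial>?PJ) = (\<integral>x. (\<integral>y. exp (t * f (merge A G (x, y))) \<partial>?PG) \<partial>?PA)"
    unfolding J by (rule PS.product_integral_fold[OF dis fin]) (use intE in \<open>simp add: J\<close>)
  also have "\<dots> \<le> (\<integral>x. exp (t * H x + D\<^sup>2 * t\<^sup>2 / 2) \<partial>?PA)"
  proof (rule integral_mono)
    show i2: "integrable ?PA (\<lambda>x. exp (t * H x + D\<^sup>2 * t\<^sup>2 / 2))"
      unfolding exp_add using A.integrable_exp_bounded[OF Hm Hb] by simp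
    show "integrable ?PA (\<lambda>x. \<integral>y. exp (t * f (merge A G (x, y))) \<partial>?PG)"
    proof (rule Bochner_Integration.integrable_bound[OF i2 m2], rule AE_I2)
      fix x assume "x \<in> space ?PA"
      moreover have "0 \<le> (\<integral>y. exp (t * f (merge A G (x, y))) \<partial>?PG)"
        by (rule Bochner_Integration.integral_nonneg) simp
      ultimately show "norm (\<integral>y. exp (t * f (merge A G (x, y))) \<partial>?PG)
          \<le> norm (exp (t * H x + D\<^sup>2 * t\<^sup>2 / 2))"
        using inner by simp
    qed
  qed (rule inner)
  also have "\<dots> = exp (D\<^sup>2 * t\<^sup>2 / 2) * (\<integral>x. exp (t * H x) \<partial>?PA)"
    unfolding exp_add by (simp add: mult.commute)
  also have "\<dots> \<le> exp (D\<^sup>2 * t\<^sup>2 / 2) * exp (t * (\<integral>x. H x \<partial>?PA) + real c * D\<^sup>2 * t\<^sup>2 / 2)"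
    using IH by (intro mult_left_mono) auto
  also have "(\<integral>x. H x \<partial>?PA) = (\<integral>x. f x \<partial>?PJ)"
    unfolding H_def J by (rule PS.product_integral_fold[OF dis fin, symmetric])
      (use intJ in \<open>simp add: J\<close>)
  also have "exp (D\<^sup>2 * t\<^sup>2 / 2) * exp (t * (\<integral>x. f x \<partial>?PJ) + real c * D\<^sup>2 * t\<^sup>2 / 2)
      = exp (t * (\<integral>x. f x \<partial>?PJ) + real (Suc c) * D\<^sup>2 * t\<^sup>2 / 2)"
    unfolding exp_add[symmetric] by (simp add: field_simps)
  finally show ?case .
qed

section \<open>Paths and their optimal gains\<close>

text \<open>Payoffs lie in \<open>{-B..B}\<close> only almost surely; clipping makes all bounds hold everywhere.\<close>

definition clip :: "real \<Rightarrow> real \<Rightarrow> real" where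
  "clip B t = max (- B) (min B t)"

lemma abs_clip_le: "0 \<le> B \<Longrightarrow> \<bar>clip B t\<bar> \<le> B"
  unfolding clip_def by auto

lemma clip_eq: "\<bar>t\<bar> \<le> B \<Longrightarrow> clip B t = t"
  unfolding clip_def by auto

lemma clip_measurable [measurable]: "clip B \<in> borel_measurable borel"
  unfolding clip_def[abs_def] by measurable

primrec path_edges :: "'z::monoid_add \<Rightarrow> 'z list \<Rightarrow> ('z \<times> 'z) list" where
  "path_edges z [] = []"
| "path_edges z (i # is) = (z, i) # path_edges (z + i) is"

definition path_sum :: "('z::monoid_add \<times> 'z \<Rightarrow> real) \<Rightarrow> 'z \<Rightarrow> 'z list \<Rightarrow> real" where
  "path_sum w z is = (\<Sum>e\<leftarrow>path_edges z is. w e)"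

text \<open>With \<open>w\<close> the realised payoffs and \<open>Q\<close> all paths of length
  \<open>n\<close>, this is \<open>n\<close> times the \<open>n\<close>-stage value.\<close>

definition best :: "('z::monoid_add \<times> 'z \<Rightarrow> real) \<Rightarrow> 'z \<Rightarrow> 'z list set \<Rightarrow> real" where
  "best w z Q = Max (path_sum w z ` Q)"

definition edges :: "'z::monoid_add \<Rightarrow> 'z list set \<Rightarrow> ('z \<times> 'z) set" where
  "edges z Q = (\<Union>is\<in>Q. set (path_edges z is))"

definition paths :: "'z set \<Rightarrow> nat \<Rightarrow> 'z list set" where
  "paths I n = {is. set is \<subseteq> I \<and> length is = n}"

definition ends :: "'z::monoid_add set \<Rightarrow> nat \<Rightarrow> 'z set" where
  "ends I n = sum_list ` paths I n"

text \<open>Prescribing the displacement makes the starting state of the continuation deterministic,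
  so that the gains before and after it depend on fixed disjoint sets of payoffs.\<close>

definition bridges :: "'z::monoid_add set \<Rightarrow> nat \<Rightarrow> 'z \<Rightarrow> 'z list set" where
  "bridges I n u = {is \<in> paths I n. sum_list is = u}"

lemma length_path_edges [simp]: "length (path_edges z is) = length is"
  by (induction "is" arbitrary: z) auto

lemma path_edges_append:
  "path_edges z (is @ js) = path_edges z is @ path_edges (z + sum_list is) js"
  by (induction "is" arbitrary: z) (auto simp: add.assoc)

lemma path_sum_append: "path_sum w z (is @ js) = path_sum w z is + path_sum w (z + sum_list is) js"
  unfolding path_sum_def path_edges_append by simp

lemma snd_path_edges: "e \<in> set (path_edges z is) \<Longrightarrow> snd e \<in> set is"
  by (induction "is" arbitrary: z) auto

text \<open>An additive map commutes with partial sums. The shift by \<open>z\<close> lets one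
  statement cover both translations (\<open>h\<close> the identity) and the folding of the
  plane.\<close>

lemma path_edges_map:
  assumes "\<And>a b. h (a + b) = h a + h b"
  shows "path_edges (z + h y) (map h is) = map (\<lambda>e. (z + h (fst e), h (snd e))) (path_edges y is)"
proof (induction "is" arbitrary: y)
  case (Cons i "is")
  show ?case using Cons.IH[of "y + i"] by (simp add: assms add.assoc)
qed simp

lemma path_sum_cong:
  "(\<And>e. e \<in> set (path_edges z is) \<Longrightarrow> w e = w' e) \<Longrightarrow> path_sum w z is = path_sum w' z is"
  unfolding path_sum_def by (simp cong: map_cong)

lemma abs_sum_list_le:
  assumes "\<And>e. e \<in> set L \<Longrightarrow> \<bar>w e :: real\<bar> \<le> B"
  shows "\<bar>\<Sum>e\<leftarrow>L. w e\<bar> \<le> real (length L) * B"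
  using assms
proof (induction L)
  case (Cons e L)
  have "\<bar>w e\<bar> \<le> B" "\<bar>\<Sum>e\<leftarrow>L. w e\<bar> \<le> real (length L) * B" using Cons by auto
  then show ?case by (simp add: algebra_simps)
qed simp

lemma abs_path_sum_le:
  assumes "\<And>e. \<bar>w e\<bar> \<le> B"
  shows "\<bar>path_sum w z is\<bar> \<le> real (length is) * B"
  unfolding path_sum_def using abs_sum_list_le[of "path_edges z is" w B] assms by simp

lemma best_cong:
  "(\<And>e. e \<in> edges z Q \<Longrightarrow> w e = w' e) \<Longrightarrow> best w z Q = best w' z Q"
  unfolding best_def edges_def
  by (intro arg_cong[where f = Max] image_cong refl path_sum_cong) auto

lemma best_ge: "finite Q \<Longrightarrow> is \<in> Q \<Longrightarrow> path_sum w z is \<le> best w z Q"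
  unfolding best_def by auto

lemma best_attained:
  assumes "finite Q" "Q \<noteq> {}"
  obtains "is" where "is \<in> Q" "best w z Q = path_sum w z is"
proof -
  have "best w z Q \<in> path_sum w z ` Q"
    unfolding best_def by (rule Max_in) (use assms in auto)
  then show ?thesis using that by blast
qed

lemma abs_best_le:
  assumes "finite Q" "Q \<noteq> {}" "\<And>is. is \<in> Q \<Longrightarrow> length is = n" "\<And>e. \<bar>w e\<bar> \<le> B"
  shows "\<bar>best w z Q\<bar> \<le> real n * B"
proof -
  obtain "is" where "is \<in> Q" "best w z Q = path_sum w z is"
    using best_attained[OF assms(1,2)] .
  then show ?thesis using abs_path_sum_le[of w B z "is"] assms(3,4) by simp
qed

text \<open>A maximum is 1-Lipschitz for the sup norm: a path optimal for one weight is a competitor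
  for the other.\<close>

lemma best_diff_le:
  assumes "finite Q" "Q \<noteq> {}"
    and "\<And>is. is \<in> Q \<Longrightarrow> \<bar>path_sum w z is - path_sum w' z is\<bar> \<le> D"
  shows "\<bar>best w z Q - best w' z Q\<bar> \<le> D"
proof -
  have le: "best v z Q \<le> best v' z Q + D"
    if d: "\<And>is. is \<in> Q \<Longrightarrow> \<bar>path_sum v z is - path_sum v' z is\<bar> \<le> D" for v v'
  proof -
    obtain "is" where i: "is \<in> Q" "best v z Q = path_sum v z is"
      using best_attained[OF assms(1,2)] .
    with d[OF i(1)] best_ge[OF assms(1) i(1), of v' z] show ?thesis by linarith
  qed
  show ?thesis using le[of w w'] le[of w' w] assms(3) by (simp add: abs_minus_commute abs_le_iff)
qed

lemma edges_snd: "e \<in> edges z Q \<Longrightarrow> (\<And>is. is \<in> Q \<Longrightarrow> set is \<subseteq> I) \<Longrightarrow> snd e \<in> I"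
  unfolding edges_def using snd_path_edges by fastforce

lemma finite_edges: "finite Q \<Longrightarrow> finite (edges z Q)"
  unfolding edges_def by simp

lemma best_map:
  assumes "\<And>a b. h (a + b) = h a + h b"
  shows "best w (z + h y) (map h ` Q) = best (\<lambda>e. w (z + h (fst e), h (snd e))) y Q"
  unfolding best_def path_sum_def image_image path_edges_map[of h, OF assms] by (simp add: comp_def)

section \<open>Sets of paths, their endpoints and their concatenation\<close>

lemma finite_paths [simp]: "finite I \<Longrightarrow> finite (paths I n)"
  unfolding paths_def by (rule finite_lists_length_eq)

lemma paths_nonempty [simp]: "I \<noteq> {} \<Longrightarrow> paths I n \<noteq> {}"
proof -
  assume "I \<noteq> {}"
  then obtain i where "i \<in> I" by blast
  then have "replicate n i \<in> paths I n" unfolding paths_def by auto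
  then show ?thesis by blast
qed

lemma paths_0 [simp]: "paths I 0 = {[]}"
  unfolding paths_def by auto

lemma paths_length: "is \<in> paths I n \<Longrightarrow> length is = n"
  and paths_set: "is \<in> paths I n \<Longrightarrow> set is \<subseteq> I"
  unfolding paths_def by auto

lemma finite_bridges [simp]: "finite I \<Longrightarrow> finite (bridges I n u)"
  unfolding bridges_def by simp

lemma bridges_nonempty: "u \<in> ends I n \<Longrightarrow> bridges I n u \<noteq> {}"
  unfolding bridges_def ends_def by auto

lemma bridges_subset: "bridges I n u \<subseteq> paths I n"
  unfolding bridges_def by auto

lemma finite_ends [simp]: "finite I \<Longrightarrow> finite (ends I n)"
  unfolding ends_def by simp

lemma ends_nonempty [simp]: "I \<noteq> {} \<Longrightarrow> ends I n \<noteq> {}"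
  unfolding ends_def by simp

lemma paths_append: "is \<in> paths I n \<Longrightarrow> js \<in> paths I k \<Longrightarrow> is @ js \<in> paths I (n + k)"
  unfolding paths_def by auto

lemma paths_map: "map h ` paths I n = paths (h ` I) n"
proof
  show "map h ` paths I n \<subseteq> paths (h ` I) n" unfolding paths_def by force
  show "paths (h ` I) n \<subseteq> map h ` paths I n"
  proof
    fix js assume "js \<in> paths (h ` I) n"
    then have "js \<in> lists (h ` I)" and n: "length js = n" unfolding paths_def by auto
    then obtain "is" where "is \<in> lists I" "js = map h is" by (auto simp: lists_image)
    with n show "js \<in> map h ` paths I n" unfolding paths_def by auto
  qed
qed

text \<open>An optimal bridge to \<open>u\<close> followed by an optimal path from
  \<open>z + u\<close> is a competitor among all paths of length \<open>n + k\<close>.\<close>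

lemma best_split_ge:
  assumes "finite I" "I \<noteq> {}" "u \<in> ends I n"
  shows "best w z (bridges I n u) + best w (z + u) (paths I k) \<le> best w z (paths I (n + k))"
proof -
  obtain "is" where i: "is \<in> bridges I n u" "best w z (bridges I n u) = path_sum w z is"
    using best_attained[OF finite_bridges[OF assms(1)] bridges_nonempty[OF assms(3)]] .
  obtain js where j: "js \<in> paths I k" "best w (z + u) (paths I k) = path_sum w (z + u) js"
    using best_attained[OF finite_paths[OF assms(1)] paths_nonempty[OF assms(2)]] .
  have "is @ js \<in> paths I (n + k)"
    using i(1) j(1) bridges_subset[of I n u] paths_append by blast
  moreover have "path_sum w z (is @ js) = path_sum w z is + path_sum w (z + u) js"
    using i(1) unfolding path_sum_append bridges_def by simp
  ultimately show ?thesis using best_ge[OF finite_paths[OF assms(1)]] i(2) j(2) by metis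
qed

text \<open>Cut an optimal path after \<open>n\<close> stages. The displacement \<open>u\<close>
  found there depends on \<open>w\<close>, which is why a union bound over \<open>ends I n\<close>
  is used later.\<close>

lemma best_split_le:
  assumes "finite I" "I \<noteq> {}"
  obtains u where "u \<in> ends I n"
    "best w z (paths I (n + k)) \<le> best w z (bridges I n u) + best w (z + u) (paths I k)"
proof -
  obtain ks where k: "ks \<in> paths I (n + k)" "best w z (paths I (n + k)) = path_sum w z ks"
    using best_attained[OF finite_paths[OF assms(1)] paths_nonempty[OF assms(2)]] .
  define "is" js where "is = take n ks" and "js = drop n ks"
  have ks: "ks = is @ js" unfolding is_def js_def by simp
  have i: "is \<in> paths I n" and j: "js \<in> paths I k"
    using k(1) unfolding is_def js_def paths_def by (auto dest: in_set_takeD in_set_dropD)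
  have "is \<in> bridges I n (sum_list is)" using i unfolding bridges_def by simp
  then have "path_sum w z is \<le> best w z (bridges I n (sum_list is))"
    by (rule best_ge[OF finite_bridges[OF assms(1)]])
  moreover have "path_sum w (z + sum_list is) js \<le> best w (z + sum_list is) (paths I k)"
    by (rule best_ge[OF finite_paths[OF assms(1)] j])
  ultimately have "best w z (paths I (n + k))
      \<le> best w z (bridges I n (sum_list is)) + best w (z + sum_list is) (paths I k)"
    unfolding k(2) unfolding ks path_sum_append by linarith
  moreover have "sum_list is \<in> ends I n" using i unfolding ends_def by simp
  ultimately show ?thesis using that by blast
qed

lemma best_paths_eq_bridges:
  assumes "finite I" "I \<noteq> {}"
  obtains u where "u \<in> ends I n" "best w z (paths I n) = best w z (bridges I n u)"
proof -
  obtain "is" where k: "is \<in> paths I n" "best w z (paths I n) = path_sum w z is"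
    using best_attained[OF finite_paths[OF assms(1)] paths_nonempty[OF assms(2)]] .
  have i: "is \<in> bridges I n (sum_list is)" using k(1) unfolding bridges_def by simp
  have "path_sum w z is \<le> best w z (bridges I n (sum_list is))"
    by (rule best_ge[OF finite_bridges[OF assms(1)] i])
  moreover have "best w z (bridges I n (sum_list is)) \<le> best w z (paths I n)"
    unfolding best_def using bridges_subset[of I n] i finite_paths[OF assms(1), of n]
    by (intro Max_mono image_mono) auto
  ultimately have "best w z (paths I n) = best w z (bridges I n (sum_list is))"
    using k(2) by simp
  moreover have "sum_list is \<in> ends I n" using k(1) unfolding ends_def by simp
  ultimately show ?thesis using that by blast
qed

text \<open>Addition is commutative, so an endpoint is determined by how often \<alpha> is played, a
  number between 0 and \<open>n\<close>.\<close>

lemma card_ends_le: "card (ends {\<alpha>, \<beta> :: 'z::comm_monoid_add} n) \<le> Suc n"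
proof -
  have "sum_list is \<in> (\<lambda>k. sum_list (replicate k \<alpha>) + sum_list (replicate (length is - k) \<beta>)) ` {..length is}"
    if "set is \<subseteq> {\<alpha>, \<beta>}" for "is"
    using that
  proof (induction "is")
    case (Cons i "is")
    then obtain k where k: "k \<le> length is"
      "sum_list is = sum_list (replicate k \<alpha>) + sum_list (replicate (length is - k) \<beta>)" by auto
    from Cons.prems consider "i = \<alpha>" | "i = \<beta>" by auto
    then show ?case
    proof cases
      case 1
      then show ?thesis using k by (intro image_eqI[of _ _ "Suc k"]) (auto simp: add_ac)
    next
      case 2
      then show ?thesis using k
        by (intro image_eqI[of _ _ k]) (auto simp: add_ac Suc_diff_le)
    qed
  qed simp
  then have "ends {\<alpha>, \<beta>} n \<subseteq> (\<lambda>k. sum_list (replicate k \<alpha>) + sum_list (replicate (n - k) \<beta>)) ` {..n}"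
    unfolding ends_def paths_def by fastforce
  from card_mono[OF _ this] have "card (ends {\<alpha>, \<beta>} n)
      \<le> card ((\<lambda>k. sum_list (replicate k \<alpha>) + sum_list (replicate (n - k) \<beta>)) ` {..n})" by simp
  also have "\<dots> \<le> card {..n}" by (rule card_image_le) simp
  finally show ?thesis by simp
qed

text \<open>Ranks are distinct along \<open>L\<close>, so at most one summand has rank
  \<open>k\<close>, and all the others agree.\<close>

lemma sum_list_ranked_diff:
  assumes "distinct (map r L)" "\<And>e. e \<in> set L \<Longrightarrow> r e \<noteq> k \<Longrightarrow> w e = (w' e :: real)"
    and "\<And>e. \<bar>w e - w' e\<bar> \<le> D"
  shows "\<bar>(\<Sum>e\<leftarrow>L. w e) - (\<Sum>e\<leftarrow>L. w' e)\<bar> \<le> D"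
  using assms(1,2)
proof (induction L)
  case Nil
  have "0 \<le> D" using assms(3)[of undefined] by linarith
  then show ?case by simp
next
  case (Cons e L)
  show ?case
  proof (cases "r e = k")
    case True
    have "w e' = w' e'" if "e' \<in> set L" for e'
      using Cons.prems(2)[of e'] Cons.prems(1) that True by (auto simp: image_iff)
    then have "(\<Sum>e\<leftarrow>L. w e) = (\<Sum>e\<leftarrow>L. w' e)" by (simp cong: map_cong)
    then show ?thesis using assms(3)[of e] by simp
  next
    case False
    then show ?thesis using Cons by auto
  qed
qed

section \<open>Measurability and laws of optimal gains\<close>

lemma sum_list_measurable:
  assumes "set L \<subseteq> J" "\<And>j. j \<in> J \<Longrightarrow> sets (N j) = sets borel"
  shows "(\<lambda>x. \<Sum>e\<leftarrow>L. clip B (x e)) \<in> borel_measurable (PiM J N)"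
  using assms(1)
proof (induction L)
  case (Cons e L)
  then have "(\<lambda>x. x e) \<in> measurable (PiM J N) (N e)"
    by (intro measurable_component_singleton) auto
  then have [measurable]: "(\<lambda>x. x e) \<in> borel_measurable (PiM J N)"
    using assms(2)[of e] Cons.prems by (simp cong: measurable_cong_sets)
  have [measurable]: "(\<lambda>x. \<Sum>e\<leftarrow>L. clip B (x e)) \<in> borel_measurable (PiM J N)"
    using Cons by simp
  show ?case by simp
qed simp

lemma best_measurable:
  assumes "finite Q" "edges z Q \<subseteq> J" "\<And>j. j \<in> J \<Longrightarrow> sets (N j) = sets borel"
  shows "(\<lambda>x. best (\<lambda>e. clip B (x e)) z Q) \<in> borel_measurable (PiM J N)"
  unfolding best_def path_sum_def
  by (intro borel_measurable_Max assms(1) sum_list_measurable)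
    (use assms(2,3) in \<open>auto simp: edges_def\<close>)

text \<open>The expectation is taken over independent payoffs of law \<open>F\<close> on the edges
  of \<open>Q\<close>, clipped at \<open>B\<close>. It refers to no particular environment, so gains
  on the line and in the plane become comparable.\<close>

definition path_law :: "real measure \<Rightarrow> real \<Rightarrow> (real \<Rightarrow> real) \<Rightarrow> 'z::monoid_add list set \<Rightarrow> real" where
  "path_law F B \<Phi> Q = (\<integral>x. \<Phi> (best (\<lambda>e. clip B (x e)) 0 Q) \<partial>PiM (edges 0 Q) (\<lambda>_. F))"

text \<open>The variance proxy \<open>4 c B\<^sup>2\<close> is that of \<open>c\<close> independent groups of payoffs, each of which changes
  the optimal gain by at most \<open>2 B\<close>.\<close>

definition mgf_bound :: "real measure \<Rightarrow> real \<Rightarrow> nat \<Rightarrow> 'z::monoid_add list set \<Rightarrow> bool" where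
  "mgf_bound F B c Q \<longleftrightarrow>
    (\<forall>t. path_law F B (\<lambda>s. exp (t * s)) Q
      \<le> exp (t * path_law F B (\<lambda>s. s) Q + 2 * real c * B\<^sup>2 * t\<^sup>2))"

text \<open>An edge is grouped by the rank of its starting state. A path meets each group at most
  once, so changing a whole group moves every path sum, hence the maximum, by at most
  \<open>2 * B\<close>; bounded differences with \<open>D = 2 * B\<close> give the constant.\<close>

lemma mgf_bound_ranked:
  fixes Q :: "'z::monoid_add list set"
  assumes F: "real_distribution F" and B: "0 \<le> B" and Q: "finite Q" "Q \<noteq> {}"
    and len: "\<And>is. is \<in> Q \<Longrightarrow> length is = n"
    and dist: "\<And>is. is \<in> Q \<Longrightarrow> distinct (map (\<lambda>e. r (fst e)) (path_edges 0 is))"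
    and lt: "\<And>e. e \<in> edges 0 Q \<Longrightarrow> r (fst e) < c"
  shows "mgf_bound F B c Q"
  unfolding mgf_bound_def
proof
  fix t
  interpret F: real_distribution F by fact
  let ?f = "\<lambda>x. best (\<lambda>e. clip B (x e)) 0 Q"
  have "(\<integral>x. exp (t * ?f x) \<partial>PiM (edges 0 Q) (\<lambda>_. F))
    \<le> exp (t * (\<integral>x. ?f x \<partial>PiM (edges 0 Q) (\<lambda>_. F)) + real c * (2 * B)\<^sup>2 * t\<^sup>2 / 2)"
  proof (rule bounded_differences_mgf[where r = "\<lambda>e. r (fst e)" and C = "real n * B"])
    show "prob_space F" by (rule F.prob_space_axioms)
    show "finite (edges 0 Q)" using Q(1) by (rule finite_edges)
    show "?f \<in> borel_measurable (PiM (edges 0 Q) (\<lambda>_. F))"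
      using Q(1) by (intro best_measurable) auto
    show "\<bar>?f x\<bar> \<le> real n * B" for x
      by (rule abs_best_le[OF Q]) (use len abs_clip_le[OF B] in auto)
    show "r (fst e) < c" if "e \<in> edges 0 Q" for e using lt that .
    fix x y :: "'z \<times> 'z \<Rightarrow> real" and k
    assume eq: "\<And>e. e \<in> edges 0 Q \<Longrightarrow> r (fst e) \<noteq> k \<Longrightarrow> x e = y e"
    show "\<bar>?f x - ?f y\<bar> \<le> 2 * B"
    proof (rule best_diff_le[OF Q])
      fix "is" assume i: "is \<in> Q"
      show "\<bar>path_sum (\<lambda>e. clip B (x e)) 0 is - path_sum (\<lambda>e. clip B (y e)) 0 is\<bar> \<le> 2 * B"
        unfolding path_sum_def
      proof (rule sum_list_ranked_diff[OF dist[OF i], of k])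
        fix e assume "e \<in> set (path_edges 0 is)" "r (fst e) \<noteq> k"
        then have "x e = y e" using i by (intro eq) (auto simp: edges_def)
        then show "clip B (x e) = clip B (y e)" by simp
      next
        fix e show "\<bar>clip B (x e) - clip B (y e)\<bar> \<le> 2 * B"
          using abs_clip_le[OF B, of "x e"] abs_clip_le[OF B, of "y e"] by linarith
      qed
    qed
  qed
  then show "path_law F B (\<lambda>s. exp (t * s)) Q
      \<le> exp (t * path_law F B (\<lambda>s. s) Q + 2 * real c * B\<^sup>2 * t\<^sup>2)"
    unfolding path_law_def by (simp add: power2_eq_square mult_ac)
qed

section \<open>Oriented walks in an i.i.d. environment\<close>

text \<open>The orientation enters through the additive height \<open>\<phi>\<close>: edges used before reaching a state lie
  strictly below it, edges used afterwards do not.\<close>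

locale iid_walk = prob_space M
  for M :: "'a measure" +
  fixes \<alpha> \<beta> :: "'z::ab_group_add"
    and g :: "'a \<Rightarrow> 'z \<Rightarrow> 'z \<Rightarrow> real"
    and F :: "real measure"
    and B :: real
    and \<phi> :: "'z \<Rightarrow> int"
    and K :: nat
  assumes F: "real_distribution F"
    and B: "0 \<le> B"
    and indep: "indep_vars (\<lambda>_. borel) (\<lambda>(z, i) \<omega>. g \<omega> z i) (UNIV \<times> {\<alpha>, \<beta>})"
    and distr_g: "\<And>z i. i \<in> {\<alpha>, \<beta>} \<Longrightarrow> distr M borel (\<lambda>\<omega>. g \<omega> z i) = F"
    and phi_add: "\<And>x y. \<phi> (x + y) = \<phi> x + \<phi> y"
    and phi_pos: "\<And>i. i \<in> {\<alpha>, \<beta>} \<Longrightarrow> 1 \<le> \<phi> i"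
    and phi_le: "\<And>i. i \<in> {\<alpha>, \<beta>} \<Longrightarrow> \<phi> i \<le> int K"
begin

abbreviation I :: "'z set" where "I \<equiv> {\<alpha>, \<beta>}"

definition W :: "'a \<Rightarrow> 'z \<times> 'z \<Rightarrow> real" where
  "W \<omega> e = clip B (g \<omega> (fst e) (snd e))"

section \<open>Joint laws of finitely many payoffs and of optimal gains\<close>

lemma abs_W_le: "\<bar>W \<omega> e\<bar> \<le> B"
  unfolding W_def by (rule abs_clip_le[OF B])

lemma g_measurable: "i \<in> I \<Longrightarrow> (\<lambda>\<omega>. g \<omega> z i) \<in> borel_measurable M"
  using indep unfolding indep_vars_def by fastforce

text \<open>Injectivity of \<open>r\<close> means that no payoff is read twice, so the payoffs at
  the edges \<open>r j\<close> are again independent with law \<open>F\<close> and their joint law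
  is the product measure.\<close>

lemma expectation_edges:
  fixes h :: "('j \<Rightarrow> real) \<Rightarrow> real"
  assumes "finite J" and inj: "inj_on r J" and r: "\<And>j. j \<in> J \<Longrightarrow> snd (r j) \<in> I"
    and h: "h \<in> borel_measurable (PiM J (\<lambda>_. borel))"
  shows "expectation (\<lambda>\<omega>. h (\<lambda>j\<in>J. g \<omega> (fst (r j)) (snd (r j))))
    = (\<integral>x. h x \<partial>PiM J (\<lambda>_. F))"
proof -
  let ?X = "\<lambda>j \<omega>. g \<omega> (fst (r j)) (snd (r j))"
  interpret F: real_distribution F by (rule F)
  have m: "?X j \<in> borel_measurable M" if "j \<in> J" for j
    using g_measurable r[OF that] .
  have "distr M (PiM J (\<lambda>_. borel)) (\<lambda>\<omega>. \<lambda>j\<in>J. ?X j \<omega>) = PiM J (\<lambda>_. F)"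
  \<comment> \<open>The characterisation of independence by the product law is for nonempty index
    sets; for empty \<open>J\<close> both sides are the point mass at the undefined
    function.\<close>
  proof (cases "J = {}")
    case True
    interpret P: prob_space "PiM J (\<lambda>_. F)" by (rule prob_space_PiM) (rule F.prob_space_axioms)
    have mm: "(\<lambda>\<omega>. \<lambda>j\<in>J. ?X j \<omega>) \<in> measurable M (PiM J (\<lambda>_. borel))"
      by (rule measurable_restrict) (rule m)
    have e: "PiM J (\<lambda>_. F) = PiM J (\<lambda>_. borel)" by (rule PiM_cong) (auto simp: True)
    show ?thesis
    proof (rule measure_eqI)
      fix A assume A: "A \<in> sets (distr M (PiM J (\<lambda>_. borel)) (\<lambda>\<omega>. \<lambda>j\<in>J. ?X j \<omega>))"
      then have "A \<in> sets (PiM J (\<lambda>_. F))" by (simp add: e)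
      then have "A \<subseteq> {\<lambda>_. undefined}" using sets.sets_into_space True by (fastforce simp: space_PiM)
      then consider "A = {}" | "A = {\<lambda>_. undefined}" by blast
      then show "emeasure (distr M (PiM J (\<lambda>_. borel)) (\<lambda>\<omega>. \<lambda>j\<in>J. ?X j \<omega>)) A
          = emeasure (PiM J (\<lambda>_. F)) A"
      proof cases
        case 2
        then have "A = space (PiM J (\<lambda>_. F))" by (simp add: True space_PiM)
        then show ?thesis
          using P.emeasure_space_1 prob_space.emeasure_space_1[OF prob_space_distr[OF mm]]
          by (simp add: e)
      qed simp
    qed (simp add: e)
  next
    case False
    \<comment> \<open>Reindexing: the restrictions to the disjoint singletons \<open>{r j}\<close>
      are independent, and evaluation at \<open>r j\<close> recovers the payoffs.\<close>
    have "indep_vars (\<lambda>j. PiM {r j} (\<lambda>_. borel))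
        (\<lambda>j \<omega>. restrict (\<lambda>e. (\<lambda>(z, i) \<omega>. g \<omega> z i) e \<omega>) {r j}) J"
      by (rule indep_vars_restrict[OF indep])
        (use r inj in \<open>auto simp: disjoint_family_on_def inj_on_def mem_Times_iff\<close>)
    then have "indep_vars (\<lambda>_. borel)
        (\<lambda>j \<omega>. (restrict (\<lambda>e. (\<lambda>(z, i) \<omega>. g \<omega> z i) e \<omega>) {r j}) (r j)) J"
      by (rule indep_vars_compose2[where Y = "\<lambda>j x. x (r j)"])
        (rule measurable_component_singleton, simp)
    then have "indep_vars (\<lambda>_. borel) ?X J" by (simp add: case_prod_beta)
    then have "distr M (PiM J (\<lambda>_. borel)) (\<lambda>\<omega>. \<lambda>j\<in>J. ?X j \<omega>)
        = PiM J (\<lambda>j. distr M borel (?X j))"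
      using indep_vars_iff_distr_eq_PiM'[where I = J and M' = "\<lambda>_. borel" and X = ?X] False m by simp
    also have "\<dots> = PiM J (\<lambda>_. F)" by (rule PiM_cong) (use distr_g r in auto)
    finally show ?thesis .
  qed
  then have "(\<integral>x. h x \<partial>PiM J (\<lambda>_. F))
      = (\<integral>x. h x \<partial>distr M (PiM J (\<lambda>_. borel)) (\<lambda>\<omega>. \<lambda>j\<in>J. ?X j \<omega>))" by simp
  also have "\<dots> = expectation (\<lambda>\<omega>. h (\<lambda>j\<in>J. ?X j \<omega>))"
    by (rule integral_distr) (use m h in \<open>auto intro!: measurable_restrict\<close>)
  finally show ?thesis by simp
qed

text \<open>The gain along image paths is the gain along the paths in \<open>Q\<close> for the
  payoffs pulled back by \<open>h\<close>. These are i.i.d. as long as \<open>h\<close> identifies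
  no two edges that \<open>Q\<close> uses, whatever it does elsewhere.\<close>

lemma expectation_best_map:
  fixes h :: "'y::monoid_add \<Rightarrow> 'z"
  assumes add: "\<And>a b. h (a + b) = h a + h b"
    and Q: "finite Q" "\<And>is. is \<in> Q \<Longrightarrow> h ` set is \<subseteq> I"
    and inj: "inj_on (\<lambda>e. (h (fst e), h (snd e))) (edges 0 Q)"
    and [measurable]: "\<Phi> \<in> borel_measurable borel"
  shows "expectation (\<lambda>\<omega>. \<Phi> (best (W \<omega>) z (map h ` Q))) = path_law F B \<Phi> Q"
proof -
  have h0: "h 0 = 0" using add[of 0 0] by simp
  let ?J = "edges 0 Q"
  let ?r = "\<lambda>e. (z + h (fst e), h (snd e))"
  have mb: "(\<lambda>x. best (\<lambda>e. clip B (x e)) 0 Q) \<in> borel_measurable (PiM ?J (\<lambda>_. borel))"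
    using Q(1) by (intro best_measurable) auto
  have "best (W \<omega>) z (map h ` Q)
      = best (\<lambda>e. clip B ((\<lambda>e\<in>?J. g \<omega> (fst (?r e)) (snd (?r e))) e)) 0 Q" for \<omega>
  proof -
    have "best (W \<omega>) z (map h ` Q) = best (\<lambda>e. W \<omega> (?r e)) 0 Q"
      using best_map[of h "W \<omega>" z 0 Q, OF add] by (simp add: h0)
    also have "\<dots> = best (\<lambda>e. clip B ((\<lambda>e\<in>?J. g \<omega> (fst (?r e)) (snd (?r e))) e)) 0 Q"
      by (rule best_cong) (simp add: W_def)
    finally show ?thesis .
  qed
  then have "expectation (\<lambda>\<omega>. \<Phi> (best (W \<omega>) z (map h ` Q)))
      = expectation (\<lambda>\<omega>. (\<lambda>x. \<Phi> (best (\<lambda>e. clip B (x e)) 0 Q))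
          (\<lambda>e\<in>?J. g \<omega> (fst (?r e)) (snd (?r e))))"
    by simp
  also have "\<dots> = path_law F B \<Phi> Q"
    unfolding path_law_def
  proof (rule expectation_edges)
    show "finite ?J" using Q(1) by (rule finite_edges)
    show "inj_on ?r ?J" using inj by (auto simp: inj_on_def)
    show "snd (?r e) \<in> I" if "e \<in> ?J" for e
      using that snd_path_edges Q(2) unfolding edges_def by fastforce
    show "(\<lambda>x. \<Phi> (best (\<lambda>e. clip B (x e)) 0 Q)) \<in> borel_measurable (PiM ?J (\<lambda>_. borel))"
      using mb by measurable
  qed
  finally show ?thesis .
qed

text \<open>This is stationarity, the case of \<open>h\<close> the identity: the law of the optimal
  gain does not depend on the initial state \<open>z\<close>.\<close>

lemma expectation_best:
  assumes "finite Q" "\<And>is. is \<in> Q \<Longrightarrow> set is \<subseteq> I" "\<Phi> \<in> borel_measurable borel"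
  shows "expectation (\<lambda>\<omega>. \<Phi> (best (W \<omega>) z Q)) = path_law F B \<Phi> Q"
  using expectation_best_map[of "\<lambda>x. x" Q \<Phi> z] assms by simp

lemma best_W_measurable:
  assumes "finite Q" "\<And>is. is \<in> Q \<Longrightarrow> set is \<subseteq> I"
  shows "(\<lambda>\<omega>. best (W \<omega>) z Q) \<in> borel_measurable M"
proof -
  have "(\<lambda>\<omega>. \<lambda>e\<in>edges z Q. g \<omega> (fst e) (snd e)) \<in> measurable M (PiM (edges z Q) (\<lambda>_. borel))"
    by (intro measurable_restrict g_measurable edges_snd[OF _ assms(2)])
  moreover have "(\<lambda>x. best (\<lambda>e. clip B (x e)) z Q) \<in> borel_measurable (PiM (edges z Q) (\<lambda>_. borel))"
    using assms(1) by (intro best_measurable) auto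
  ultimately have "(\<lambda>\<omega>. best (\<lambda>e. clip B ((\<lambda>e\<in>edges z Q. g \<omega> (fst e) (snd e)) e)) z Q) \<in> borel_measurable M"
    by (rule measurable_compose)
  also have "(\<lambda>\<omega>. best (\<lambda>e. clip B ((\<lambda>e\<in>edges z Q. g \<omega> (fst e) (snd e)) e)) z Q)
      = (\<lambda>\<omega>. best (W \<omega>) z Q)"
    by (intro ext best_cong) (simp add: W_def)
  finally show ?thesis .
qed

lemma
  assumes "Q \<subseteq> paths I n" "Q \<noteq> {}"
  shows abs_best_W_le: "\<bar>best (W \<omega>) z Q\<bar> \<le> real n * B"
    and best_W_borel: "(\<lambda>\<omega>. best (W \<omega>) z Q) \<in> borel_measurable M"
    and integrable_best_W: "integrable M (\<lambda>\<omega>. best (W \<omega>) z Q)"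
    and integrable_exp_best_W: "integrable M (\<lambda>\<omega>. exp (t * best (W \<omega>) z Q))"
proof -
  have fin: "finite Q" using assms(1) finite_subset[of Q "paths I n"] by simp
  show b: "\<bar>best (W \<omega>) z Q\<bar> \<le> real n * B" for \<omega>
    by (rule abs_best_le[OF fin assms(2)]) (use assms(1) abs_W_le in \<open>auto simp: paths_def\<close>)
  show m: "(\<lambda>\<omega>. best (W \<omega>) z Q) \<in> borel_measurable M"
    by (rule best_W_measurable[OF fin]) (use assms(1) in \<open>auto simp: paths_def\<close>)
  show "integrable M (\<lambda>\<omega>. best (W \<omega>) z Q)" using m b by (rule integrable_bounded)
  show "integrable M (\<lambda>\<omega>. exp (t * best (W \<omega>) z Q))" using m b by (rule integrable_exp_bounded)
qed

text \<open>Each optimal gain is a function of the payoffs on its own edges, and payoffs on disjoint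
  sets of edges are independent.\<close>

lemma expectation_indep_best:
  assumes Q1: "Q1 \<subseteq> paths I n" "Q1 \<noteq> {}" and Q2: "Q2 \<subseteq> paths I k" "Q2 \<noteq> {}"
    and dis: "edges z1 Q1 \<inter> edges z2 Q2 = {}"
  shows "expectation (\<lambda>\<omega>. exp (t * best (W \<omega>) z1 Q1) * exp (t * best (W \<omega>) z2 Q2))
    = expectation (\<lambda>\<omega>. exp (t * best (W \<omega>) z1 Q1)) * expectation (\<lambda>\<omega>. exp (t * best (W \<omega>) z2 Q2))"
proof (rule indep_var_lebesgue_integral)
  let ?X = "\<lambda>(z, i) \<omega>. g \<omega> z i"
  let ?R = "\<lambda>J \<omega>. restrict (\<lambda>e. ?X e \<omega>) J"
  have fin: "finite Q1" "finite Q2"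
    using Q1(1) Q2(1) finite_subset[of _ "paths I _"] by (meson finite.emptyI finite_insert finite_paths)+
  have sub: "edges z1 Q1 \<subseteq> UNIV \<times> I" "edges z2 Q2 \<subseteq> UNIV \<times> I"
  proof -
    have "edges z Q \<subseteq> UNIV \<times> I" if "Q \<subseteq> paths I l" for z Q l
    proof
      fix e assume "e \<in> edges z Q"
      then have "snd e \<in> I" by (rule edges_snd) (use that paths_set in blast)
      then show "e \<in> UNIV \<times> I" by (simp add: mem_Times_iff)
    qed
    then show "edges z1 Q1 \<subseteq> UNIV \<times> I" "edges z2 Q2 \<subseteq> UNIV \<times> I" using Q1(1) Q2(1) by blast+
  qed
  let ?f = "\<lambda>z Q x. exp (t * best (\<lambda>e. clip B (x e)) z Q)"
  have m: "?f z Q \<in> borel_measurable (PiM (edges z Q) (\<lambda>_. borel))" if "finite Q" for z Q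
  proof -
    have "(\<lambda>x. best (\<lambda>e. clip B (x e)) z Q) \<in> borel_measurable (PiM (edges z Q) (\<lambda>_. borel))"
      using that by (intro best_measurable) auto
    then show ?thesis by measurable
  qed
  have eq: "?f z Q \<circ> ?R (edges z Q) = (\<lambda>\<omega>. exp (t * best (W \<omega>) z Q))" for z Q
  proof
    fix \<omega>
    have "best (\<lambda>e. clip B (?R (edges z Q) \<omega> e)) z Q = best (W \<omega>) z Q"
      by (rule best_cong) (simp add: W_def case_prod_beta)
    then show "(?f z Q \<circ> ?R (edges z Q)) \<omega> = exp (t * best (W \<omega>) z Q)" by simp
  qed
  have "indep_var (PiM (edges z1 Q1) (\<lambda>_. borel)) (?R (edges z1 Q1))
      (PiM (edges z2 Q2) (\<lambda>_. borel)) (?R (edges z2 Q2))"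
    by (rule indep_var_restrict[OF indep dis sub])
  then have "indep_var borel (?f z1 Q1 \<circ> ?R (edges z1 Q1)) borel (?f z2 Q2 \<circ> ?R (edges z2 Q2))"
    by (rule indep_var_compose) (use m fin in auto)
  then show "indep_var borel (\<lambda>\<omega>. exp (t * best (W \<omega>) z1 Q1)) borel (\<lambda>\<omega>. exp (t * best (W \<omega>) z2 Q2))"
    unfolding eq .
qed (use integrable_exp_best_W Q1 Q2 in blast)+

section \<open>Heights along paths\<close>

lemma phi_0: "\<phi> 0 = 0"
  using phi_add[of 0 0] by simp

text \<open>Each action raises the height by at least 1 and at most \<open>K\<close>. The first two
  bounds separate the edges used before a state from those used after it; the third limits the
  number of heights available as ranks.\<close>

lemma phi_path_edges:
  "set is \<subseteq> I \<Longrightarrow> e \<in> set (path_edges z is) \<Longrightarrow>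
    \<phi> z \<le> \<phi> (fst e) \<and> \<phi> (fst e) < \<phi> (z + sum_list is) \<and> \<phi> (fst e) < \<phi> z + int K * int (length is)"
proof (induction "is" arbitrary: z)
  case (Cons i "is")
  have i: "1 \<le> \<phi> i" "\<phi> i \<le> int K" using Cons.prems(1) phi_pos phi_le by auto
  have s: "0 \<le> \<phi> (sum_list js)" if "set js \<subseteq> I" for js
    using that
  proof (induction js)
    case (Cons j js)
    then show ?case using phi_pos[of j] by (simp add: phi_add)
  qed (simp add: phi_0)
  show ?case
  proof (cases "e = (z, i)")
    case True
    have "0 \<le> int K * int (length is)" by simp
    then have "0 < int K + int K * int (length is)" using i by linarith
    then show ?thesis using True i s[of "is"] Cons.prems(1) by (simp add: phi_add algebra_simps)
  next
    case False
    then have "\<phi> (z + i) \<le> \<phi> (fst e) \<and> \<phi> (fst e) < \<phi> (z + i + sum_list is)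
        \<and> \<phi> (fst e) < \<phi> (z + i) + int K * int (length is)"
      using Cons by auto
    then show ?thesis using i by (auto simp: phi_add add.assoc algebra_simps)
  qed
qed simp

text \<open>Heights increase strictly along a path, and starting at a nonnegative height prevents
  \<open>nat\<close> from merging them.\<close>

lemma distinct_phi_path_edges:
  "set is \<subseteq> I \<Longrightarrow> 0 \<le> \<phi> z \<Longrightarrow> distinct (map (\<lambda>e. nat (\<phi> (fst e))) (path_edges z is))"
proof (induction "is" arbitrary: z)
  case (Cons i "is")
  have i: "1 \<le> \<phi> i" using Cons.prems(1) phi_pos by auto
  have "nat (\<phi> z) \<noteq> nat (\<phi> (fst e))" if "e \<in> set (path_edges (z + i) is)" for e
    using phi_path_edges[of "is" e "z + i"] that Cons.prems i by (auto simp: phi_add)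
  then show ?case using Cons i by (auto simp: phi_add)
qed simp

text \<open>Heights below \<open>K * n\<close> serve as ranks. In the plane \<open>K = 1\<close>,
  which gives \<open>n\<close> ranks; on the line with actions 1 and \<open>m\<close> the height
  gives \<open>K = m\<close>, enough for the existence of the limit but not for uniformity in
  \<open>m\<close>.\<close>

lemma mgf_bound_phi:
  assumes "Q \<subseteq> paths I n" "Q \<noteq> {}"
  shows "mgf_bound F B (K * n) Q"
proof (rule mgf_bound_ranked[where r = "\<lambda>y. nat (\<phi> y)" and n = n])
  show "finite Q" using assms(1) finite_subset[of Q "paths I n"] by simp
  fix "is" assume "is \<in> Q"
  then have i: "is \<in> paths I n" using assms(1) by auto
  show "length is = n" using i by (rule paths_length)
  show "distinct (map (\<lambda>e. nat (\<phi> (fst e))) (path_edges 0 is))"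
    by (rule distinct_phi_path_edges) (use i in \<open>auto simp: phi_0 paths_def\<close>)
next
  fix e assume "e \<in> edges 0 Q"
  then obtain "is" where i: "is \<in> paths I n" "e \<in> set (path_edges 0 is)"
    using assms(1) unfolding edges_def by auto
  have "0 \<le> \<phi> (fst e) \<and> \<phi> (fst e) < int (K * n)"
    using phi_path_edges[of "is" e 0] i by (simp add: phi_0 paths_def)
  then show "nat (\<phi> (fst e)) < K * n" by linarith
qed (use F B assms(2) in auto)

section \<open>Means and exponential moments of gains over blocks\<close>

lemma path_law_eq:
  assumes "Q \<subseteq> paths I n" "\<Phi> \<in> borel_measurable borel"
  shows "path_law F B \<Phi> Q = expectation (\<lambda>\<omega>. \<Phi> (best (W \<omega>) z Q))"
proof (rule expectation_best[symmetric])
  show "finite Q" using assms(1) finite_subset[of Q "paths I n"] by simp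
qed (use assms in \<open>auto simp: paths_def\<close>)

lemma path_law_id:
  "Q \<subseteq> paths I n \<Longrightarrow> path_law F B (\<lambda>s. s) Q = expectation (\<lambda>\<omega>. best (W \<omega>) z Q)"
  by (rule path_law_eq) simp_all

lemma bridges_ends:
  assumes "u \<in> ends I n"
  shows "bridges I n u \<subseteq> paths I n" "bridges I n u \<noteq> {}"
  using bridges_subset bridges_nonempty[OF assms] by auto

text \<open>Jensen's inequality; it turns bounds on exponential moments back into bounds on
  means.\<close>

lemma exp_path_law_le:
  assumes "Q \<subseteq> paths I n" "Q \<noteq> {}"
  shows "exp (t * path_law F B (\<lambda>s. s) Q) \<le> path_law F B (\<lambda>s. exp (t * s)) Q"
  using exp_expectation_le[of "\<lambda>\<omega>. t * best (W \<omega>) 0 Q"] integrable_best_W[OF assms]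
    integrable_exp_best_W[OF assms]
  by (simp add: path_law_eq[OF assms(1), where z = 0])

definition mean :: "nat \<Rightarrow> real" where
  "mean n = path_law F B (\<lambda>s. s) (paths I n)"

lemma path_law_bridges_le_mean:
  assumes "u \<in> ends I n"
  shows "path_law F B (\<lambda>s. s) (bridges I n u) \<le> mean n"
  unfolding mean_def path_law_id[OF bridges_ends(1)[OF assms], where z = 0]
    path_law_id[OF subset_refl, where z = 0]
proof (rule integral_mono)
  fix \<omega>
  show "best (W \<omega>) 0 (bridges I n u) \<le> best (W \<omega>) 0 (paths I n)"
    unfolding best_def using bridges_ends[OF assms] by (intro Max_mono image_mono) auto
qed (use integrable_best_W[OF bridges_ends[OF assms]] integrable_best_W[OF subset_refl, of n] in auto)

text \<open>Union bound over the state reached after \<open>n\<close> stages.\<close>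

lemma mgf_paths_add_le:
  assumes t: "0 \<le> t"
  shows "path_law F B (\<lambda>s. exp (t * s)) (paths I (n + k))
    \<le> (\<Sum>u\<in>ends I n. path_law F B (\<lambda>s. exp (t * s)) (bridges I n u))
      * path_law F B (\<lambda>s. exp (t * s)) (paths I k)"
proof -
  let ?E = "\<lambda>z Q \<omega>. exp (t * best (W \<omega>) z Q)"
  have pn: "paths I j \<subseteq> paths I j" "paths I j \<noteq> {}" for j :: nat by auto
  have dis: "edges 0 (bridges I n u) \<inter> edges u (paths I k) = {}" for u
  proof -
    have "\<phi> (fst e) < \<phi> u" if "e \<in> edges 0 (bridges I n u)" for e
      using that phi_path_edges[of _ e 0] unfolding edges_def bridges_def paths_def by fastforce
    moreover have "\<phi> u \<le> \<phi> (fst e)" if "e \<in> edges u (paths I k)" for e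
      using that phi_path_edges[of _ e u] unfolding edges_def paths_def by auto
    ultimately show ?thesis by fastforce
  qed
  have int: "integrable M (\<lambda>\<omega>. ?E 0 (bridges I n u) \<omega> * ?E u (paths I k) \<omega>)"
    if u: "u \<in> ends I n" for u
  proof (rule integrable_bounded[where C = "exp (t * (real n * B)) * exp (t * (real k * B))"])
    show "(\<lambda>\<omega>. ?E 0 (bridges I n u) \<omega> * ?E u (paths I k) \<omega>) \<in> borel_measurable M"
      using best_W_borel[OF bridges_ends[OF u]] best_W_borel[OF pn] by measurable
    fix \<omega>
    have "best (W \<omega>) 0 (bridges I n u) \<le> real n * B" "best (W \<omega>) u (paths I k) \<le> real k * B"
      using abs_best_W_le[OF bridges_ends[OF u], where \<omega> = \<omega> and z = 0]
        abs_best_W_le[OF pn(1)[of k] pn(2)[of k], where \<omega> = \<omega> and z = u]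
      by (simp_all add: abs_le_iff)
    then show "\<bar>?E 0 (bridges I n u) \<omega> * ?E u (paths I k) \<omega>\<bar>
        \<le> exp (t * (real n * B)) * exp (t * (real k * B))"
      using t by (simp add: abs_mult mult_mono mult_left_mono)
  qed
  have "path_law F B (\<lambda>s. exp (t * s)) (paths I (n + k)) = expectation (?E 0 (paths I (n + k)))"
    by (rule path_law_eq) auto
  also have "\<dots> \<le> expectation (\<lambda>\<omega>. \<Sum>u\<in>ends I n. ?E 0 (bridges I n u) \<omega> * ?E u (paths I k) \<omega>)"
  proof (rule integral_mono)
    show "integrable M (?E 0 (paths I (n + k)))" using integrable_exp_best_W[OF pn] .
    show "integrable M (\<lambda>\<omega>. \<Sum>u\<in>ends I n. ?E 0 (bridges I n u) \<omega> * ?E u (paths I k) \<omega>)"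
      using int by (intro Bochner_Integration.integrable_sum) auto
    fix \<omega>
    obtain u where u: "u \<in> ends I n" and le: "best (W \<omega>) 0 (paths I (n + k))
        \<le> best (W \<omega>) 0 (bridges I n u) + best (W \<omega>) (0 + u) (paths I k)"
      using best_split_le[where I = I and w = "W \<omega>" and z = 0 and n = n and k = k] by blast
    have "t * best (W \<omega>) 0 (paths I (n + k))
        \<le> t * (best (W \<omega>) 0 (bridges I n u) + best (W \<omega>) u (paths I k))"
      using le t by (intro mult_left_mono) auto
    then have "?E 0 (paths I (n + k)) \<omega>
        \<le> exp (t * best (W \<omega>) 0 (bridges I n u) + t * best (W \<omega>) u (paths I k))"
      by (simp add: distrib_left)
    also have "\<dots> = ?E 0 (bridges I n u) \<omega> * ?E u (paths I k) \<omega>" by (rule exp_add)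
    \<comment> \<open>The state \<open>u\<close> depends on \<omega>; as all terms are positive, its
      term is at most the sum over all endpoints.\<close>
    also have "\<dots> \<le> (\<Sum>u\<in>ends I n. ?E 0 (bridges I n u) \<omega> * ?E u (paths I k) \<omega>)"
      using u by (intro member_le_sum[where f = "\<lambda>u. ?E 0 (bridges I n u) \<omega> * ?E u (paths I k) \<omega>"]) auto
    finally show "?E 0 (paths I (n + k)) \<omega>
        \<le> (\<Sum>u\<in>ends I n. ?E 0 (bridges I n u) \<omega> * ?E u (paths I k) \<omega>)" .
  qed
  also have "\<dots> = (\<Sum>u\<in>ends I n. expectation (\<lambda>\<omega>. ?E 0 (bridges I n u) \<omega> * ?E u (paths I k) \<omega>))"
    using int by (intro Bochner_Integration.integral_sum) auto
  also have "\<dots> = (\<Sum>u\<in>ends I n. path_law F B (\<lambda>s. exp (t * s)) (bridges I n u)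
      * path_law F B (\<lambda>s. exp (t * s)) (paths I k))"
  proof (rule sum.cong[OF refl])
    fix u assume u: "u \<in> ends I n"
    have "expectation (\<lambda>\<omega>. ?E 0 (bridges I n u) \<omega> * ?E u (paths I k) \<omega>)
        = expectation (?E 0 (bridges I n u)) * expectation (?E u (paths I k))"
      by (rule expectation_indep_best[OF bridges_ends[OF u] pn dis])
    moreover have "expectation (?E 0 (bridges I n u)) = path_law F B (\<lambda>s. exp (t * s)) (bridges I n u)"
      by (rule path_law_eq[OF bridges_ends(1)[OF u], symmetric]) simp
    moreover have "expectation (?E u (paths I k)) = path_law F B (\<lambda>s. exp (t * s)) (paths I k)"
      by (rule path_law_eq[OF pn(1), symmetric]) simp
    ultimately show "expectation (\<lambda>\<omega>. ?E 0 (bridges I n u) \<omega> * ?E u (paths I k) \<omega>)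
        = path_law F B (\<lambda>s. exp (t * s)) (bridges I n u) * path_law F B (\<lambda>s. exp (t * s)) (paths I k)"
      by simp
  qed
  finally show ?thesis by (simp add: sum_distrib_right)
qed

lemma path_law_nonneg: "0 \<le> path_law F B (\<lambda>s. exp (t * s)) Q"
  unfolding path_law_def by (rule Bochner_Integration.integral_nonneg) simp

lemma card_ends_bounds: "1 \<le> real (card (ends I n))" "real (card (ends I n)) \<le> real n + 1"
proof -
  have "0 < card (ends I n)" by (simp add: card_gt_0_iff)
  then show "1 \<le> real (card (ends I n))" by simp
  show "real (card (ends I n)) \<le> real n + 1" using card_ends_le[of \<alpha> \<beta> n] by linarith
qed

text \<open>Iterating the union bound over \<open>k\<close> blocks bounds the exponential moment by
  a \<open>k\<close>-th power. Jensen's inequality, a logarithm and division by \<open>t\<close>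
  leave two errors per block: \<open>ln (real n + 1) / t\<close> for the choice of endpoint and
  \<open>2 * real c * B\<^sup>2 * t\<close> for the fluctuations.\<close>

lemma mean_mult_le:
  assumes bd: "\<And>u. u \<in> ends I n \<Longrightarrow> mgf_bound F B c (bridges I n u)" and t: "0 < t"
  shows "mean (k * n) \<le> real k * (mean n + ln (real n + 1) / t + 2 * real c * B\<^sup>2 * t)"
proof -
  \<comment> \<open>A bound for the factor contributed by one block: at most \<open>n + 1\<close>
    endpoints, each with a bridge of mean at most \<open>mean n\<close>.\<close>
  let ?a = "(real n + 1) * exp (t * mean n + 2 * real c * B\<^sup>2 * t\<^sup>2)"
  have s: "(\<Sum>u\<in>ends I n. path_law F B (\<lambda>s. exp (t * s)) (bridges I n u)) \<le> ?a"
  proof -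
    have "path_law F B (\<lambda>s. exp (t * s)) (bridges I n u) \<le> exp (t * mean n + 2 * real c * B\<^sup>2 * t\<^sup>2)"
      if u: "u \<in> ends I n" for u
    proof -
      have "path_law F B (\<lambda>s. exp (t * s)) (bridges I n u)
          \<le> exp (t * path_law F B (\<lambda>s. s) (bridges I n u) + 2 * real c * B\<^sup>2 * t\<^sup>2)"
        using bd[OF u] unfolding mgf_bound_def by blast
      also have "\<dots> \<le> exp (t * mean n + 2 * real c * B\<^sup>2 * t\<^sup>2)"
        using path_law_bridges_le_mean[OF u] t by simp
      finally show ?thesis .
    qed
    then have "(\<Sum>u\<in>ends I n. path_law F B (\<lambda>s. exp (t * s)) (bridges I n u))
        \<le> real (card (ends I n)) * exp (t * mean n + 2 * real c * B\<^sup>2 * t\<^sup>2)"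
      by (rule sum_bounded_above)
    also have "\<dots> \<le> ?a" using card_ends_bounds(2) by (intro mult_right_mono) auto
    finally show ?thesis .
  qed
  have pow: "path_law F B (\<lambda>s. exp (t * s)) (paths I (k * n)) \<le> ?a ^ k"
  proof (induction k)
    case 0
    have "best w z {[]} = 0" for w and z :: 'z
      by (simp add: best_def path_sum_def)
    then show ?case
      using path_law_eq[of "paths I 0" 0 "\<lambda>s. exp (t * s)" 0] by (simp add: prob_space)
  next
    case (Suc k)
    have "path_law F B (\<lambda>s. exp (t * s)) (paths I (Suc k * n))
        \<le> (\<Sum>u\<in>ends I n. path_law F B (\<lambda>s. exp (t * s)) (bridges I n u))
          * path_law F B (\<lambda>s. exp (t * s)) (paths I (k * n))"
      using mgf_paths_add_le[of t n "k * n"] t by simp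
    also have "\<dots> \<le> ?a * ?a ^ k"
      by (intro mult_mono s Suc.IH path_law_nonneg) auto
    finally show ?case by simp
  qed
  have "exp (t * mean (k * n)) \<le> path_law F B (\<lambda>s. exp (t * s)) (paths I (k * n))"
    unfolding mean_def by (rule exp_path_law_le[OF subset_refl]) simp
  also note pow
  finally have "ln (exp (t * mean (k * n))) \<le> ln (?a ^ k)"
    by (subst ln_le_cancel_iff) auto
  then have "t * mean (k * n) \<le> real k * (ln (real n + 1) + (t * mean n + 2 * real c * B\<^sup>2 * t\<^sup>2))"
    by (simp add: ln_realpow ln_mult)
  also have "\<dots> = t * (real k * (mean n + ln (real n + 1) / t + 2 * real c * B\<^sup>2 * t))"
    using t by (simp add: field_simps power2_eq_square)
  finally show ?thesis using t by simp
qed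

text \<open>A maximum of at most \<open>n + 1\<close> concentrated variables is close to the largest of their means,
  so some deterministic endpoint is almost optimal.\<close>

lemma obtain_good_end:
  assumes bd: "\<And>u. u \<in> ends I n \<Longrightarrow> mgf_bound F B c (bridges I n u)" and t: "0 < t"
  obtains u where "u \<in> ends I n"
    "mean n - ln (real n + 1) / t - 2 * real c * B\<^sup>2 * t \<le> path_law F B (\<lambda>s. s) (bridges I n u)"
proof -
  let ?m = "\<lambda>u. path_law F B (\<lambda>s. s) (bridges I n u)"
  \<comment> \<open>The endpoint chosen is the one whose bridge has the largest mean, so its mean
    bounds those of all terms in the sum below.\<close>
  have "Max (?m ` ends I n) \<in> ?m ` ends I n" by (rule Max_in) auto
  then obtain u where u: "u \<in> ends I n" and mx: "Max (?m ` ends I n) = ?m u"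
    by (rule imageE)
  have mu: "?m u' \<le> ?m u" if "u' \<in> ends I n" for u'
    unfolding mx[symmetric] using that by (intro Max_ge) auto
  let ?E = "\<lambda>z Q \<omega>. exp (t * best (W \<omega>) z Q)"
  have "exp (t * mean n) \<le> path_law F B (\<lambda>s. exp (t * s)) (paths I n)"
    unfolding mean_def by (rule exp_path_law_le[OF subset_refl]) simp
  also have "\<dots> = expectation (?E 0 (paths I n))"
    by (rule path_law_eq) auto
  also have "\<dots> \<le> expectation (\<lambda>\<omega>. \<Sum>u\<in>ends I n. ?E 0 (bridges I n u) \<omega>)"
  proof (rule integral_mono)
    show "integrable M (?E 0 (paths I n))" by (rule integrable_exp_best_W[OF subset_refl]) simp
    show "integrable M (\<lambda>\<omega>. \<Sum>u\<in>ends I n. ?E 0 (bridges I n u) \<omega>)"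
      using integrable_exp_best_W[OF bridges_ends] by (intro Bochner_Integration.integrable_sum) auto
    fix \<omega>
    obtain v where v: "v \<in> ends I n" "best (W \<omega>) 0 (paths I n) = best (W \<omega>) 0 (bridges I n v)"
      using best_paths_eq_bridges[where I = I and w = "W \<omega>" and z = 0 and n = n] by blast
    then show "?E 0 (paths I n) \<omega> \<le> (\<Sum>u\<in>ends I n. ?E 0 (bridges I n u) \<omega>)"
      using member_le_sum[of v "ends I n" "\<lambda>u. ?E 0 (bridges I n u) \<omega>"] by simp
  qed
  also have "\<dots> = (\<Sum>u\<in>ends I n. expectation (?E 0 (bridges I n u)))"
    using integrable_exp_best_W[OF bridges_ends] by (intro Bochner_Integration.integral_sum) auto
  also have "\<dots> \<le> real (card (ends I n)) * exp (t * ?m u + 2 * real c * B\<^sup>2 * t\<^sup>2)"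
  proof (rule sum_bounded_above)
    fix v assume v: "v \<in> ends I n"
    have "expectation (?E 0 (bridges I n v)) = path_law F B (\<lambda>s. exp (t * s)) (bridges I n v)"
      by (rule path_law_eq[OF bridges_ends(1)[OF v], symmetric]) simp
    also have "\<dots> \<le> exp (t * ?m v + 2 * real c * B\<^sup>2 * t\<^sup>2)"
      using bd[OF v] unfolding mgf_bound_def by blast
    also have "\<dots> \<le> exp (t * ?m u + 2 * real c * B\<^sup>2 * t\<^sup>2)"
      using mu[OF v] t by simp
    finally show "expectation (?E 0 (bridges I n v)) \<le> exp (t * ?m u + 2 * real c * B\<^sup>2 * t\<^sup>2)" .
  qed
  also have "\<dots> \<le> (real n + 1) * exp (t * ?m u + 2 * real c * B\<^sup>2 * t\<^sup>2)"
    using card_ends_bounds(2) by (intro mult_right_mono) auto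
  finally have "ln (exp (t * mean n)) \<le> ln ((real n + 1) * exp (t * ?m u + 2 * real c * B\<^sup>2 * t\<^sup>2))"
    by (subst ln_le_cancel_iff) auto
  then have "t * mean n \<le> ln (real n + 1) + (t * ?m u + 2 * real c * B\<^sup>2 * t\<^sup>2)"
    by (simp add: ln_mult)
  also have "\<dots> = t * (?m u + ln (real n + 1) / t + 2 * real c * B\<^sup>2 * t)"
    using t by (simp add: field_simps power2_eq_square)
  finally have "mean n \<le> ?m u + ln (real n + 1) / t + 2 * real c * B\<^sup>2 * t" using t by simp
  then show ?thesis using that[OF u] by simp
qed

text \<open>Forcing the play through \<open>u\<close>, \<open>2 u\<close>, ..., \<open>k u\<close>
  can only lower the gain, and every block then has the same mean.\<close>

lemma mean_mult_ge:
  assumes u: "u \<in> ends I n"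
  shows "real k * path_law F B (\<lambda>s. s) (bridges I n u) \<le> mean (k * n)"
proof (induction k)
  case 0
  have "best w z {[]} = 0" for w and z :: 'z
    by (simp add: best_def path_sum_def)
  then show ?case unfolding mean_def
    using path_law_eq[of "paths I 0" 0 "\<lambda>s. s" 0] by simp
next
  case (Suc k)
  have pn: "paths I j \<subseteq> paths I j" "paths I j \<noteq> {}" for j by auto
  \<comment> \<open>By stationarity the mean over the remaining stages may be computed with initial
    state \<open>u\<close>.\<close>
  have "path_law F B (\<lambda>s. s) (bridges I n u) + mean (k * n)
      = expectation (\<lambda>\<omega>. best (W \<omega>) 0 (bridges I n u)) + expectation (\<lambda>\<omega>. best (W \<omega>) u (paths I (k * n)))"
    unfolding mean_def path_law_id[OF bridges_ends(1)[OF u], where z = 0]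
      path_law_id[OF subset_refl, where z = u] by simp
  also have "\<dots> = expectation (\<lambda>\<omega>. best (W \<omega>) 0 (bridges I n u) + best (W \<omega>) u (paths I (k * n)))"
    using integrable_best_W[OF bridges_ends[OF u]] integrable_best_W[OF pn] by simp
  also have "\<dots> \<le> expectation (\<lambda>\<omega>. best (W \<omega>) 0 (paths I (n + k * n)))"
  proof (rule integral_mono)
    fix \<omega>
    show "best (W \<omega>) 0 (bridges I n u) + best (W \<omega>) u (paths I (k * n)) \<le> best (W \<omega>) 0 (paths I (n + k * n))"
      using best_split_ge[where I = I and u = u and n = n and w = "W \<omega>" and z = 0 and k = "k * n"] u by simp
  qed (use integrable_best_W[OF bridges_ends[OF u]] integrable_best_W[OF pn] in auto)
  also have "\<dots> = mean (Suc k * n)"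
    unfolding mean_def path_law_id[OF subset_refl, where z = 0] by simp
  finally show ?case using Suc.IH by (simp add: algebra_simps)
qed

lemma mean_mult_bound:
  assumes bd: "\<And>u. u \<in> ends I n \<Longrightarrow> mgf_bound F B c (bridges I n u)" and t: "0 < t"
  shows "\<bar>mean (k * n) - real k * mean n\<bar> \<le> real k * (ln (real n + 1) / t + 2 * real c * B\<^sup>2 * t)"
proof -
  obtain u where u: "u \<in> ends I n"
    "mean n - ln (real n + 1) / t - 2 * real c * B\<^sup>2 * t \<le> path_law F B (\<lambda>s. s) (bridges I n u)"
    using obtain_good_end[OF bd t] .
  have "real k * (mean n - ln (real n + 1) / t - 2 * real c * B\<^sup>2 * t)
      \<le> real k * path_law F B (\<lambda>s. s) (bridges I n u)"
    using u(2) by (intro mult_left_mono) auto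
  also have "\<dots> \<le> mean (k * n)" by (rule mean_mult_ge[OF u(1)])
  finally show ?thesis using mean_mult_le[OF bd t, of k] by (simp add: algebra_simps abs_le_iff)
qed

end

section \<open>The limit of the mean gain\<close>

lemma (in prob_space) chernoff_upper:
  fixes X :: "'a \<Rightarrow> real"
  assumes [measurable]: "X \<in> borel_measurable M" and int: "integrable M (\<lambda>\<omega>. exp (t * X \<omega>))"
    and mgf: "expectation (\<lambda>\<omega>. exp (t * X \<omega>)) \<le> exp (t * a + s)" and t: "0 < t"
  shows "prob {\<omega> \<in> space M. a + d \<le> X \<omega>} \<le> exp (s - t * d)"
proof -
  have "prob {\<omega> \<in> space M. a + d \<le> X \<omega>}
      \<le> exp (- t * (a + d)) * (\<integral>\<omega>\<in>space M. exp (t * X \<omega>) \<partial>M)"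
  proof (rule Chernoff_ineq_ge[OF t])
    show "set_integrable M (space M) (\<lambda>\<omega>. exp (t * X \<omega>))"
      unfolding set_integrable_def by (rule integrable_mult_indicator[OF sets.top int])
  qed simp
  also have "\<dots> = exp (- t * (a + d)) * expectation (\<lambda>\<omega>. exp (t * X \<omega>))"
    using int by (simp add: set_integral_space)
  also have "\<dots> \<le> exp (- t * (a + d)) * exp (t * a + s)"
    using mgf by (intro mult_left_mono) auto
  also have "\<dots> = exp (s - t * d)" by (simp add: exp_add[symmetric] algebra_simps)
  finally show ?thesis .
qed

text \<open>Chernoff bounds make both tails at distance \<open>real n * \<delta>\<close>
  geometrically small in \<open>n\<close>. The Borel-Cantelli lemma handles each \<delta>, and the
  inverses of positive integers suffice.\<close>

lemma (in prob_space) AE_tendsto_of_mgf: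
  fixes X :: "nat \<Rightarrow> 'a \<Rightarrow> real"
  assumes meas: "\<And>n. X n \<in> borel_measurable M"
    and int: "\<And>n t. integrable M (\<lambda>\<omega>. exp (t * X n \<omega>))"
    and mgf: "\<And>n t. expectation (\<lambda>\<omega>. exp (t * X n \<omega>)) \<le> exp (t * a n + C * real n * t\<^sup>2)"
    and C: "0 \<le> C" and lim: "(\<lambda>n. a n / real n) \<longlonglongrightarrow> v"
  shows "AE \<omega> in M. (\<lambda>n. X n \<omega> / real n) \<longlonglongrightarrow> v"
proof -
  note meas[measurable]
  have ev: "AE \<omega> in M. eventually (\<lambda>n. \<bar>X n \<omega> - a n\<bar> < real n * \<delta>) sequentially" if \<delta>: "0 < \<delta>" for \<delta>
  proof -
    \<comment> \<open>This choice gives \<open>C * t \<le> \<delta> / 2\<close>, so half of the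
      linear term \<open>t * \<delta>\<close> survives as the rate \<open>s\<close>; the summand 1
      keeps the denominator positive when \<open>C = 0\<close>.\<close>
    define t where "t = \<delta> / (2 * (C + 1))"
    define s where "s = t * \<delta> / 2"
    have t: "0 < t" and s: "0 < s" using \<delta> C unfolding t_def s_def by auto
    have "C * t \<le> \<delta> / 2" using \<delta> C unfolding t_def by (simp add: field_simps)
    then have "t * (C * t) \<le> t * (\<delta> / 2)" using t by (intro mult_left_mono) auto
    then have Ct: "C * t\<^sup>2 - t * \<delta> \<le> - s"
      unfolding s_def by (simp add: power2_eq_square algebra_simps)
    define A where "A n = {\<omega> \<in> space M. real n * \<delta> \<le> \<bar>X n \<omega> - a n\<bar>}" for n
    have A[measurable]: "A n \<in> sets M" for n unfolding A_def by measurable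
    have PA: "prob (A n) \<le> 2 * exp (- s) ^ n" for n
    proof -
      have e: "exp (C * real n * t\<^sup>2 - t * (real n * \<delta>)) \<le> exp (- s) ^ n"
      proof -
        have "real n * (C * t\<^sup>2 - t * \<delta>) \<le> real n * - s" using Ct by (intro mult_left_mono) auto
        then have "exp (C * real n * t\<^sup>2 - t * (real n * \<delta>)) \<le> exp (real n * - s)"
          by (simp add: algebra_simps)
        then show ?thesis by (simp only: exp_of_nat_mult)
      qed
      let ?U = "{\<omega> \<in> space M. a n + real n * \<delta> \<le> X n \<omega>}"
      let ?L = "{\<omega> \<in> space M. - a n + real n * \<delta> \<le> - X n \<omega>}"
      have "prob ?U \<le> exp (C * real n * t\<^sup>2 - t * (real n * \<delta>))"
        by (rule chernoff_upper[OF meas int mgf t])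
      \<comment> \<open>The lower tail is the upper tail of \<open>- X n\<close>, whose moment at
        \<open>t\<close> is that of \<open>X n\<close> at \<open>- t\<close>.\<close>
      moreover have "prob ?L \<le> exp (C * real n * t\<^sup>2 - t * (real n * \<delta>))"
        by (rule chernoff_upper[OF _ _ _ t]) (use int[of "- t" n] mgf[of "- t" n] in auto)
      moreover have "prob (A n) \<le> prob (?U \<union> ?L)"
        by (rule finite_measure_mono) (auto simp: A_def)
      moreover have "prob (?U \<union> ?L) \<le> prob ?U + prob ?L"
        by (rule measure_Un_le) measurable
      ultimately show ?thesis using e by linarith
    qed
    have "summable (\<lambda>n. prob (A n))"
    proof (rule summable_comparison_test'[of "\<lambda>n. 2 * exp (- s) ^ n" 0])
      show "summable (\<lambda>n. 2 * exp (- s) ^ n)"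
        using s by (intro summable_mult summable_geometric) auto
    qed (use PA in auto)
    then have "AE \<omega> in M. eventually (\<lambda>n. \<omega> \<in> space M - A n) sequentially"
      by (intro borel_cantelli_AE1) (auto simp: emeasure_eq_measure)
    then show ?thesis
    proof eventually_elim
      case (elim \<omega>)
      then show ?case by eventually_elim (simp add: A_def not_le)
    qed
  qed
  have "AE \<omega> in M. \<forall>j. eventually (\<lambda>n. \<bar>X n \<omega> - a n\<bar> < real n * inverse (real (Suc j))) sequentially"
    unfolding AE_all_countable using ev by simp
  then show ?thesis
  proof eventually_elim
    case (elim \<omega>)
    have "(\<lambda>n. X n \<omega> / real n - a n / real n) \<longlonglongrightarrow> 0"
    proof (rule LIMSEQ_I)
      fix r :: real assume "0 < r"
      then obtain j where j: "inverse (real (Suc j)) < r" using reals_Archimedean by blast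
      have "eventually (\<lambda>n. norm (X n \<omega> / real n - a n / real n - 0) < r) sequentially"
        using elim[rule_format, of j] eventually_gt_at_top[of 0]
      proof eventually_elim
        case (elim n)
        have "norm (X n \<omega> / real n - a n / real n - 0) = \<bar>X n \<omega> - a n\<bar> / real n"
          by (simp add: diff_divide_distrib[symmetric])
        also have "\<dots> < inverse (real (Suc j))" using elim by (simp add: field_simps)
        finally show ?case using j by linarith
      qed
      then show "\<exists>no. \<forall>n\<ge>no. norm (X n \<omega> / real n - a n / real n - 0) < r"
        by (simp add: eventually_sequentially)
    qed
    then show ?case using tendsto_add[OF _ lim, of "\<lambda>n. X n \<omega> / real n - a n / real n" 0] by simp
  qed
qed

definition mean_rate :: "real measure \<Rightarrow> real \<Rightarrow> 'z::monoid_add set \<Rightarrow> nat \<Rightarrow> real" where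
  "mean_rate F B J n = path_law F B (\<lambda>s. s) (paths J n) / real n"

text \<open>The error of one block per stage, \<open>(ln (real n + 1) / t + C * n * t) / n\<close>,
  at \<open>t = 1 / sqrt n\<close>.\<close>

definition rate_error :: "real \<Rightarrow> nat \<Rightarrow> real" where
  "rate_error C n = (ln (real n + 1) + C) / sqrt (real n)"

lemma rate_error_tendsto: "rate_error C \<longlonglongrightarrow> 0"
  unfolding rate_error_def[abs_def] by real_asymp

context iid_walk
begin

lemma mean_rate_mult:
  assumes n: "0 < n" and k: "0 < k"
    and bd: "\<And>u. u \<in> ends I n \<Longrightarrow> mgf_bound F B (L * n) (bridges I n u)"
  shows "\<bar>mean_rate F B I (k * n) - mean_rate F B I n\<bar> \<le> rate_error (2 * real L * B\<^sup>2) n"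
proof -
  \<comment> \<open>With \<open>L * n\<close> ranks this balances the two errors up to the
    logarithm: the fluctuation term becomes of order \<open>sqrt n\<close>, the endpoint term of
    order \<open>sqrt n * ln n\<close>.\<close>
  let ?t = "1 / sqrt (real n)"
  have sq: "sqrt (real n) * sqrt (real n) = real n" by simp
  have t: "0 < ?t" using n by simp
  have "\<bar>mean (k * n) - real k * mean n\<bar>
      \<le> real k * (ln (real n + 1) / ?t + 2 * real (L * n) * B\<^sup>2 * ?t)"
    by (rule mean_mult_bound[OF bd t])
  also have "ln (real n + 1) / ?t + 2 * real (L * n) * B\<^sup>2 * ?t
      = real n * rate_error (2 * real L * B\<^sup>2) n"
  proof -
    have "real n / sqrt (real n) = sqrt (real n)" by (rule real_div_sqrt) simp
    moreover have "real n * rate_error (2 * real L * B\<^sup>2) n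
        = ln (real n + 1) * (real n / sqrt (real n)) + 2 * real L * B\<^sup>2 * (real n / sqrt (real n))"
      unfolding rate_error_def by (simp add: algebra_simps add_divide_distrib)
    moreover have "2 * real (L * n) * B\<^sup>2 * ?t = 2 * real L * B\<^sup>2 * (real n / sqrt (real n))"
      by simp
    ultimately show ?thesis by simp
  qed
  finally have le: "\<bar>mean (k * n) - real k * mean n\<bar> \<le> real (k * n) * rate_error (2 * real L * B\<^sup>2) n"
    by (simp add: mult.assoc)
  have "mean_rate F B I (k * n) - mean_rate F B I n = (mean (k * n) - real k * mean n) / real (k * n)"
    using n k unfolding mean_rate_def mean_def by (simp add: diff_divide_distrib)
  then have "\<bar>mean_rate F B I (k * n) - mean_rate F B I n\<bar> = \<bar>mean (k * n) - real k * mean n\<bar> / real (k * n)"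
    by simp
  also have "\<dots> \<le> rate_error (2 * real L * B\<^sup>2) n"
    using le n k by (subst pos_divide_le_eq) (auto simp: mult.commute)
  finally show ?thesis .
qed

text \<open>The rates at \<open>k\<close> and \<open>n\<close> are both close to the rate at the
  common multiple \<open>k * n\<close>, so they form a Cauchy sequence.\<close>

lemma convergent_mean_rate: "convergent (mean_rate F B I)"
proof -
  let ?r = "mean_rate F B I" and ?e = "rate_error (2 * real K * B\<^sup>2)"
  have close: "\<bar>?r (k * n) - ?r n\<bar> \<le> ?e n" if "0 < n" "0 < k" for n k
    using that by (rule mean_rate_mult) (rule mgf_bound_phi[OF bridges_ends(1) bridges_ends(2)])
  have "Cauchy ?r"
  proof (rule CauchyI)
    fix \<epsilon> :: real assume "0 < \<epsilon>"
    then have "0 < \<epsilon> / 2" by simp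
    then have "eventually (\<lambda>n. \<bar>?e n\<bar> < \<epsilon> / 2 \<and> 0 < n) sequentially"
      using tendstoD[OF rate_error_tendsto, of "\<epsilon> / 2" "2 * real K * B\<^sup>2"]
      by (intro eventually_conj eventually_gt_at_top) (simp add: dist_real_def)
    then obtain N where N: "\<And>n. N \<le> n \<Longrightarrow> \<bar>?e n\<bar> < \<epsilon> / 2 \<and> 0 < n"
      unfolding eventually_sequentially by blast
    have "norm (?r k - ?r n) < \<epsilon>" if "N \<le> k" "N \<le> n" for k n
    proof -
      have "\<bar>?r (k * n) - ?r n\<bar> \<le> ?e n" "\<bar>?r (n * k) - ?r k\<bar> \<le> ?e k"
        using N that by (auto intro: close)
      moreover have "?e k < \<epsilon> / 2" "?e n < \<epsilon> / 2" using N[OF that(1)] N[OF that(2)] by linarith+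
      ultimately show ?thesis unfolding real_norm_def mult.commute[of n k] by linarith
    qed
    then show "\<exists>N. \<forall>k\<ge>N. \<forall>n\<ge>N. norm (?r k - ?r n) < \<epsilon>" by blast
  qed
  then show ?thesis by (simp add: Cauchy_convergent_iff)
qed

text \<open>Let the multiple tend to infinity with the block length fixed. Only bridges of the one
  length \<open>n\<close> have to satisfy the moment bound, so a constant \<open>L\<close> better
  than \<open>K\<close> can be used at a suitable length.\<close>

lemma mean_rate_limit_close:
  assumes lim: "mean_rate F B I \<longlonglongrightarrow> v" and n: "0 < n"
    and bd: "\<And>u. u \<in> ends I n \<Longrightarrow> mgf_bound F B (L * n) (bridges I n u)"
  shows "\<bar>v - mean_rate F B I n\<bar> \<le> rate_error (2 * real L * B\<^sup>2) n"
proof (rule LIMSEQ_le_const2)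
  have "strict_mono (\<lambda>k. Suc k * n)"
    using n by (intro strict_monoI) (rule mult_less_mono1, auto)
  from LIMSEQ_subseq_LIMSEQ[OF lim this]
  have "(\<lambda>k. mean_rate F B I (Suc k * n)) \<longlonglongrightarrow> v" by (simp add: comp_def)
  then show "(\<lambda>k. \<bar>mean_rate F B I (Suc k * n) - mean_rate F B I n\<bar>) \<longlonglongrightarrow> \<bar>v - mean_rate F B I n\<bar>"
    by (intro tendsto_intros)
  show "\<exists>N. \<forall>k\<ge>N. \<bar>mean_rate F B I (Suc k * n) - mean_rate F B I n\<bar> \<le> rate_error (2 * real L * B\<^sup>2) n"
    by (intro exI allI impI mean_rate_mult[OF n _ bd]) simp_all
qed

lemma AE_best_tendsto:
  assumes "mean_rate F B I \<longlonglongrightarrow> v"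
  shows "AE \<omega> in M. (\<lambda>n. best (W \<omega>) z (paths I n) / real n) \<longlonglongrightarrow> v"
proof (rule AE_tendsto_of_mgf)
  have p: "paths I n \<subseteq> paths I n" "paths I n \<noteq> {}" for n by auto
  show "(\<lambda>\<omega>. best (W \<omega>) z (paths I n)) \<in> borel_measurable M" for n
    by (rule best_W_borel[OF p])
  show "integrable M (\<lambda>\<omega>. exp (t * best (W \<omega>) z (paths I n)))" for n t
    by (rule integrable_exp_best_W[OF p])
  show "0 \<le> 2 * real K * B\<^sup>2" by simp
  show "(\<lambda>n. mean n / real n) \<longlonglongrightarrow> v"
    using assms unfolding mean_rate_def[abs_def] mean_def .
  fix n t
  have "expectation (\<lambda>\<omega>. exp (t * best (W \<omega>) z (paths I n))) = path_law F B (\<lambda>s. exp (t * s)) (paths I n)"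
    by (rule path_law_eq[OF p(1), symmetric]) simp
  also have "\<dots> \<le> exp (t * mean n + 2 * real (K * n) * B\<^sup>2 * t\<^sup>2)"
    using mgf_bound_phi[OF p(1)[of n] p(2)[of n]] unfolding mgf_bound_def mean_def by (rule spec)
  finally show "expectation (\<lambda>\<omega>. exp (t * best (W \<omega>) z (paths I n)))
      \<le> exp (t * mean n + 2 * real K * B\<^sup>2 * real n * t\<^sup>2)"
    by (simp add: mult_ac)
qed

text \<open>Both sides equal the expected value for the image paths in the same environment,
  computed once directly and once through \<open>h\<close>.\<close>

lemma path_law_map:
  fixes h :: "'y::monoid_add \<Rightarrow> 'z"
  assumes add: "\<And>a b. h (a + b) = h a + h b"
    and Q: "finite Q" "\<And>is. is \<in> Q \<Longrightarrow> h ` set is \<subseteq> I"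
    and inj: "inj_on (\<lambda>e. (h (fst e), h (snd e))) (edges 0 Q)"
    and \<Phi>: "\<Phi> \<in> borel_measurable borel"
  shows "path_law F B \<Phi> (map h ` Q) = path_law F B \<Phi> Q"
proof -
  have "path_law F B \<Phi> (map h ` Q) = expectation (\<lambda>\<omega>. \<Phi> (best (W \<omega>) 0 (map h ` Q)))"
    by (rule expectation_best[symmetric]) (use Q \<Phi> in fastforce)+
  also have "\<dots> = path_law F B \<Phi> Q"
    using add Q inj \<Phi> by (rule expectation_best_map)
  finally show ?thesis .
qed

end

section \<open>Stage values and limit values\<close>

text \<open>The complement of the support is a union of open null sets. By Lindelof's theorem
  countably many of them cover it, so it is null.\<close>

lemma measure_support_AE_bounded:
  assumes F: "real_distribution F" and "bounded (measure_support F)"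
  obtains B where "0 \<le> B" "AE x in F. \<bar>x\<bar> \<le> B"
proof -
  interpret F: real_distribution F by fact
  obtain B where B: "\<And>x. x \<in> measure_support F \<Longrightarrow> \<bar>x\<bar> \<le> B"
    using assms(2) unfolding bounded_iff by auto
  define N where "N = {U. open U \<and> emeasure F U = 0}"
  obtain N' where N': "N' \<subseteq> N" "countable N'" "\<Union>N' = \<Union>N"
    using Lindelof[of N] unfolding N_def by auto
  have "\<Union>N' \<in> null_sets F"
  proof -
    have "U \<in> null_sets F" if "U \<in> N'" for U
      using that N'(1) unfolding N_def by (auto simp: null_sets_def)
    then show ?thesis using null_sets_UN'[OF N'(2), of "\<lambda>U. U" F] by simp
  qed
  then have "AE x in F. x \<notin> \<Union>N" using N'(3) AE_not_in by metis
  then have "AE x in F. \<bar>x\<bar> \<le> max 0 B"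
  proof eventually_elim
    case (elim x)
    then have "x \<in> measure_support F"
      unfolding measure_support_def N_def by (auto simp: zero_less_iff_neq_zero)
    then show ?case using B by fastforce
  qed
  then show ?thesis using that[of "max 0 B"] by simp
qed

section \<open>Strategies as paths, and the limit values\<close>

lemma play_state_path:
  "play_state \<sigma> \<omega> z (Suc n) = z + sum_list (map (\<lambda>m. \<sigma> m (\<omega>, z)) [1..<Suc n])"
  by (induction n) (auto simp: add.assoc)

lemma stage_payoff_path:
  "stage_payoff g n \<omega> z \<sigma>
    = path_sum (\<lambda>e. g \<omega> (fst e) (snd e)) z (map (\<lambda>m. \<sigma> m (\<omega>, z)) [1..<Suc n]) / real n"
proof -
  let ?p = "\<lambda>n. map (\<lambda>m. \<sigma> m (\<omega>, z)) [1..<Suc n]"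
  have "(\<Sum>m = 1..n. g \<omega> (play_state \<sigma> \<omega> z m) (\<sigma> m (\<omega>, z)))
      = path_sum (\<lambda>e. g \<omega> (fst e) (snd e)) z (?p n)" for n
  proof (induction n)
    case 0
    show ?case by (simp add: path_sum_def)
  next
    case (Suc n)
    have "?p (Suc n) = ?p n @ [\<sigma> (Suc n) (\<omega>, z)]" by simp
    then have "path_sum (\<lambda>e. g \<omega> (fst e) (snd e)) z (?p (Suc n))
        = path_sum (\<lambda>e. g \<omega> (fst e) (snd e)) z (?p n)
          + g \<omega> (z + sum_list (?p n)) (\<sigma> (Suc n) (\<omega>, z))"
      by (simp only: path_sum_append) (simp add: path_sum_def)
    moreover have "z + sum_list (?p n) = play_state \<sigma> \<omega> z (Suc n)"
      by (rule play_state_path[symmetric])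
    ultimately show ?case using Suc.IH by (simp del: play_state.simps)
  qed
  then show ?thesis unfolding stage_payoff_def by simp
qed

text \<open>For fixed \<omega> and \<open>z\<close> a strategy amounts to one path. Conversely every
  path is realised by a strategy constant in \<omega> and the initial state, which is
  measurable.\<close>

lemma stage_value_eq_best:
  fixes I :: "(int ^ 'd) set" and M :: "'a measure"
  assumes fin: "finite I" and ne: "I \<noteq> {}" and \<omega>: "\<omega> \<in> space M"
  shows "stage_value I M g n \<omega> z = best (\<lambda>e. g \<omega> (fst e) (snd e)) z (paths I n) / real n"
proof -
  let ?w = "\<lambda>e. g \<omega> (fst e) (snd e)"
  have "stage_payoff g n \<omega> z ` strategies I M g = (\<lambda>is. path_sum ?w z is / real n) ` paths I n"
  proof (intro equalityI subsetI)
    fix x assume "x \<in> stage_payoff g n \<omega> z ` strategies I M g"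
    then obtain \<sigma> where s: "\<sigma> \<in> strategies I M g" and x: "x = stage_payoff g n \<omega> z \<sigma>" by blast
    have "\<sigma> m (\<omega>, z) \<in> I" if "1 \<le> m" for m
    proof -
      have "\<sigma> m \<in> measurable (payoff_algebra I M g \<Otimes>\<^sub>M count_space UNIV) (count_space I)"
        using s that unfolding strategies_def by blast
      from measurable_space[OF this, of "(\<omega>, z)"] show ?thesis
        using \<omega> by (simp add: space_pair_measure)
    qed
    then have "map (\<lambda>m. \<sigma> m (\<omega>, z)) [1..<Suc n] \<in> paths I n"
      unfolding paths_def by auto
    then show "x \<in> (\<lambda>is. path_sum ?w z is / real n) ` paths I n"
      unfolding x stage_payoff_path by blast
  next
    fix x assume "x \<in> (\<lambda>is. path_sum ?w z is / real n) ` paths I n"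
    then obtain "is" where i: "set is \<subseteq> I" "length is = n" and x: "x = path_sum ?w z is / real n"
      unfolding paths_def by blast
    obtain i0 where i0: "i0 \<in> I" using ne by blast
    \<comment> \<open>Stages start at 1, so stage \<open>m\<close> plays entry \<open>m - 1\<close>;
      \<open>i0\<close> fills the stages after the \<open>n\<close>-th so that the actions stay in
      \<open>I\<close>.\<close>
    define \<sigma> :: "nat \<Rightarrow> 'a \<times> (int ^ 'd) \<Rightarrow> int ^ 'd"
      where "\<sigma> m = (\<lambda>_. if m - 1 < n then is ! (m - 1) else i0)" for m
    have "\<sigma> \<in> strategies I M g"
      unfolding strategies_def
    proof (intro CollectI allI impI)
      fix m
      have "(if m - 1 < n then is ! (m - 1) else i0) \<in> I"
        using i i0 nth_mem by fastforce
      then show "\<sigma> m \<in> measurable (payoff_algebra I M g \<Otimes>\<^sub>M count_space UNIV) (count_space I)"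
        unfolding \<sigma>_def by (intro measurable_const) auto
    qed
    moreover have "map (\<lambda>m. \<sigma> m (\<omega>, z)) [1..<Suc n] = is"
      using i(2) by (intro nth_equalityI) (auto simp: \<sigma>_def simp del: upt_Suc)
    ultimately show "x \<in> stage_payoff g n \<omega> z ` strategies I M g"
      unfolding x using stage_payoff_path[of g n \<omega> z \<sigma>] by (intro image_eqI[of _ _ \<sigma>]) auto
  qed
  then have "stage_value I M g n \<omega> z = Max ((\<lambda>x. x / real n) ` (path_sum ?w z ` paths I n))"
    unfolding stage_value_def by (simp add: image_image)
  \<comment> \<open>Division by \<open>real n\<close> is monotone, also for \<open>n = 0\<close>,
    and so commutes with the maximum.\<close>
  also have "\<dots> = Max (path_sum ?w z ` paths I n) / real n"
    by (rule mono_Max_commute[symmetric]) (use fin ne in \<open>auto intro!: monoI divide_right_mono\<close>)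
  finally show ?thesis unfolding best_def .
qed

lemma pmdp_iid_walk:
  fixes \<alpha> \<beta> :: "int ^ 'd"
  assumes "pmdp {\<alpha>, \<beta>} M g" "has_payoff_distribution {\<alpha>, \<beta>} M g F" "real_distribution F" "0 \<le> B"
    and "\<And>x y. \<phi> (x + y) = \<phi> x + \<phi> y"
    and "1 \<le> \<phi> \<alpha>" "1 \<le> \<phi> \<beta>" "\<phi> \<alpha> \<le> int K" "\<phi> \<beta> \<le> int K"
  shows "iid_walk M \<alpha> \<beta> g F B \<phi> K"
proof -
  interpret pmdp "{\<alpha>, \<beta>}" M g by fact
  show ?thesis
  proof (intro iid_walk.intro[OF prob_space_axioms] iid_walk_axioms.intro)
    show "indep_vars (\<lambda>_. borel) (\<lambda>(z, i) \<omega>. g \<omega> z i) (UNIV \<times> {\<alpha>, \<beta>})" by (rule indep_payoffs)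
    show "real_distribution F" by fact
    show "distr M borel (\<lambda>\<omega>. g \<omega> z i) = F" if "i \<in> {\<alpha>, \<beta>}" for z i
      using assms(2) that unfolding has_payoff_distribution_def by blast
  qed (use assms in auto)
qed

text \<open>There are countably many edges, so a single null set serves for all of them.\<close>

lemma (in iid_walk) AE_unclipped:
  assumes AE_F: "AE x in F. \<bar>x\<bar> \<le> B" and "countable (UNIV :: 'z set)"
  shows "AE \<omega> in M. \<forall>z. \<forall>i\<in>I. g \<omega> z i = W \<omega> (z, i)"
proof -
  have "AE \<omega> in M. \<bar>g \<omega> z i\<bar> \<le> B" if i: "i \<in> I" for z i
    by (rule AE_distrD[OF g_measurable[OF i]]) (simp only: distr_g[OF i] AE_F)
  then have "AE \<omega> in M. \<forall>e\<in>UNIV \<times> I. \<bar>g \<omega> (fst e) (snd e)\<bar> \<le> B"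
    using assms(2) by (intro AE_ball_countable[THEN iffD2]) auto
  then show ?thesis
    by eventually_elim (auto simp: W_def clip_eq)
qed

text \<open>Off a null set no payoff is clipped and the stage values are the optimal gains per
  stage, whose almost sure limit is that of their means. Thus the limit value exists and can be read
  off from \<open>path_law\<close>.\<close>

lemma limit_value_eq_mean_rate:
  fixes \<alpha> \<beta> :: "int ^ 'd"
  assumes walk: "iid_walk M \<alpha> \<beta> g F B \<phi> K" and AE_F: "AE x in F. \<bar>x\<bar> \<le> B"
  shows "mean_rate F B {\<alpha>, \<beta>} \<longlonglongrightarrow> limit_value {\<alpha>, \<beta>} M g"
proof -
  interpret iid_walk M \<alpha> \<beta> g F B \<phi> K by fact
  obtain v where v: "mean_rate F B I \<longlonglongrightarrow> v"
    using convergent_mean_rate unfolding convergent_def by blast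
  have "is_limit_value I M g v"
    unfolding is_limit_value_def
  proof
    fix z
    show "AE \<omega> in M. (\<lambda>n. stage_value I M g n \<omega> z) \<longlonglongrightarrow> v"
      using AE_best_tendsto[OF v, of z] AE_unclipped[OF AE_F countableI_type] AE_space
    proof eventually_elim
      case (elim \<omega>)
      have "best (\<lambda>e. g \<omega> (fst e) (snd e)) z (paths I n) = best (W \<omega>) z (paths I n)" for n
      proof (rule best_cong)
        fix e assume "e \<in> edges z (paths I n)"
        then have "snd e \<in> I" by (rule edges_snd) (rule paths_set)
        then have "g \<omega> (fst e) (snd e) = W \<omega> (fst e, snd e)" using elim(2) by blast
        then show "g \<omega> (fst e) (snd e) = W \<omega> e" by simp
      qed
      then show ?case using elim(1,3) by (simp add: stage_value_eq_best)
    qed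
  qed
  then have "limit_value I M g = v" by (rule limit_value_eq[OF prob_space_axioms])
  then show ?thesis using v by simp
qed

section \<open>Folding the plane onto the line\<close>

text \<open>While the first coordinate stays in \<open>{0..<m}\<close>, the image determines both
  coordinates as remainder and quotient modulo \<open>m\<close>.\<close>

definition fold_plane :: "nat \<Rightarrow> int ^ 2 \<Rightarrow> int ^ 1" where
  "fold_plane m y = vec (y $ 1 + int m * y $ 2)"

lemma fold_plane_add: "fold_plane m (x + y) = fold_plane m x + fold_plane m y"
  unfolding fold_plane_def by (simp add: vec_eq_iff algebra_simps)

lemma fold_plane_axis [simp]:
  "fold_plane m (axis 1 1) = vec 1" "fold_plane m (axis 2 1) = vec (int m)"
  unfolding fold_plane_def by (simp_all add: axis_def)

lemma fold_plane_eq_iff: "fold_plane m x = fold_plane m y \<longleftrightarrow> x $ 1 + int m * x $ 2 = y $ 1 + int m * y $ 2"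
  unfolding fold_plane_def by (simp add: vec_eq_iff)

abbreviation (input) plane_actions :: "(int ^ 2) set" where
  "plane_actions \<equiv> {axis 1 1, axis 2 1}"

lemma fold_plane_actions: "fold_plane m ` plane_actions = {vec 1, vec (int m)}"
  by simp

text \<open>The last edge starts one step before the end of the path; this strictness keeps first
  coordinates below \<open>m\<close> even for paths of length \<open>m\<close> from the
  origin.\<close>

lemma path_edges_plane:
  assumes "set is \<subseteq> plane_actions" "e \<in> set (path_edges y is)"
  shows "y $ 1 \<le> fst e $ 1 \<and> y $ 2 \<le> fst e $ 2
    \<and> fst e $ 1 + fst e $ 2 < y $ 1 + y $ 2 + int (length is)"
  using assms
proof (induction "is" arbitrary: y)
  case (Cons i "is")
  show ?case
  proof (cases "e = (y, i)")
    case False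
    then have e: "e \<in> set (path_edges (y + i) is)" using Cons.prems by simp
    have "i = axis 1 1 \<or> i = axis 2 1" using Cons.prems by simp
    then have i: "0 \<le> i $ 1" "0 \<le> i $ 2" "i $ 1 + i $ 2 = 1" by (auto simp: axis_def)
    show ?thesis using Cons.IH[OF _ e] Cons.prems i by auto
  qed simp
qed simp

lemma ends_plane:
  assumes "u \<in> ends plane_actions n"
  shows "u $ 1 + u $ 2 = int n"
proof -
  have "(sum_list is) $ 1 + (sum_list is) $ 2 = int (length is)" if "set is \<subseteq> plane_actions" for "is"
    using that
  proof (induction "is")
    case (Cons i "is")
    have "i = axis 1 1 \<or> i = axis 2 1" using Cons.prems by simp
    then have i: "i $ 1 + i $ 2 = 1" by (auto simp: axis_def)
    show ?case using Cons i by auto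
  qed simp
  then show ?thesis using assms unfolding ends_def paths_def by auto
qed

text \<open>Edges start at points whose first coordinate lies in \<open>{0..<m}\<close>, so division
  by \<open>m\<close> recovers the point; the two actions stay distinct because
  \<open>2 \<le> m\<close>.\<close>

lemma inj_on_fold_plane_edges:
  assumes m: "2 \<le> m" and n: "n \<le> m" and Q: "Q \<subseteq> paths plane_actions n"
  shows "inj_on (\<lambda>e. (fold_plane m (fst e), fold_plane m (snd e))) (edges 0 Q)"
proof (rule inj_onI)
  have edge: "0 \<le> fst e $ 1 \<and> 0 \<le> fst e $ 2 \<and> fst e $ 1 + fst e $ 2 < int n \<and> snd e \<in> plane_actions"
    if e0: "e \<in> edges 0 Q" for e
  proof -
    obtain "is" where "is \<in> Q" and e: "e \<in> set (path_edges 0 is)"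
      using e0 unfolding edges_def by blast
    then have "is \<in> paths plane_actions n" using Q by blast
    then have i: "set is \<subseteq> plane_actions" "length is = n" "e \<in> set (path_edges 0 is)"
      using e paths_set paths_length by blast+
    then show ?thesis using path_edges_plane[OF i(1,3)] snd_path_edges[OF i(3)] by auto
  qed
  fix e e' assume e: "e \<in> edges 0 Q" "e' \<in> edges 0 Q"
    and eq: "(fold_plane m (fst e), fold_plane m (snd e)) = (fold_plane m (fst e'), fold_plane m (snd e'))"
  have div: "(a + int m * b) mod int m = a \<and> (a + int m * b) div int m = b"
    if "0 \<le> a" "a < int m" for a b
    using that m by simp
  have "fst e $ 1 + int m * fst e $ 2 = fst e' $ 1 + int m * fst e' $ 2"
    using eq by (simp add: fold_plane_eq_iff)
  moreover have "0 \<le> fst e $ 1" "fst e $ 1 < int m" "0 \<le> fst e' $ 1" "fst e' $ 1 < int m"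
    using edge[OF e(1)] edge[OF e(2)] n by auto
  ultimately have "fst e $ 1 = fst e' $ 1" "fst e $ 2 = fst e' $ 2" using div by metis+
  then have "fst e = fst e'" by (simp add: vec_eq_iff forall_2)
  moreover have "snd e = snd e'"
  proof -
    have "(vec 1 :: int ^ 1) \<noteq> vec (int m)" using m by (simp add: vec_eq_iff)
    then show ?thesis using eq edge[OF e(1)] edge[OF e(2)] by auto
  qed
  ultimately show "e = e'" by (simp add: prod_eq_iff)
qed

text \<open>An endpoint may have first coordinate \<open>m\<close>, so division with remainder does
  not recover it. But endpoints satisfy \<open>x $ 1 + x $ 2 = n\<close>, where the folded value is
  \<open>n + (m - 1) * x $ 2\<close>, and this is injective for \<open>2 \<le> m\<close>.\<close>

lemma bridges_fold_plane:
  assumes m: "2 \<le> m" and u: "u \<in> ends {vec 1, vec (int m)} n"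
  obtains u' where "u' \<in> ends plane_actions n"
    "bridges {vec 1, vec (int m)} n u = map (fold_plane m) ` bridges plane_actions n u'"
proof -
  let ?h = "fold_plane m" and ?I = "{vec 1, vec (int m)} :: (int ^ 1) set"
  have paths: "paths ?I n = map ?h ` paths plane_actions n"
    using paths_map[of ?h plane_actions n] by simp
  have h0: "?h 0 = 0" unfolding fold_plane_def by (simp add: vec_eq_iff)
  have sum: "sum_list (map ?h is) = ?h (sum_list is)" for "is"
    by (induction "is") (simp_all add: h0 fold_plane_add)
  obtain "is" where i: "is \<in> paths plane_actions n" "u = ?h (sum_list is)"
    using u unfolding ends_def paths by (auto simp: sum)
  have e: "sum_list js \<in> ends plane_actions n" if "js \<in> paths plane_actions n" for js
    using that unfolding ends_def by simp
  have inj: "sum_list js = sum_list is"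
    if js: "js \<in> paths plane_actions n" and eq: "?h (sum_list js) = u" for js
  proof -
    let ?x = "sum_list js" and ?y = "sum_list is"
    have s: "?x $ 1 + ?x $ 2 = int n" "?y $ 1 + ?y $ 2 = int n"
      using ends_plane e js i(1) by blast+
    have "?x $ 1 + int m * ?x $ 2 = ?y $ 1 + int m * ?y $ 2"
      using eq i(2) by (simp add: fold_plane_eq_iff)
    then have "(int m - 1) * (?x $ 2) = (int m - 1) * (?y $ 2)"
      using s by (simp add: algebra_simps)
    then have "?x $ 2 = ?y $ 2" using m by simp
    then show ?thesis using s by (simp add: vec_eq_iff forall_2)
  qed
  have "bridges ?I n u = map ?h ` bridges plane_actions n (sum_list is)"
    unfolding bridges_def paths using inj i(2) by (auto simp: sum)
  then show ?thesis using that e[OF i(1)] by blast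
qed

lemma path_law_fold_plane:
  assumes walk: "iid_walk M (vec 1 :: int ^ 1) (vec (int m)) g F B \<phi> K"
    and m: "2 \<le> m" and n: "n \<le> m" and Q: "Q \<subseteq> paths plane_actions n"
    and \<Phi>: "\<Phi> \<in> borel_measurable borel"
  shows "path_law F B \<Phi> (map (fold_plane m) ` Q) = path_law F B \<Phi> Q"
proof (rule iid_walk.path_law_map[OF walk])
  show "fold_plane m (a + b) = fold_plane m a + fold_plane m b" for a b by (rule fold_plane_add)
  show "finite Q" using Q finite_subset[of Q "paths plane_actions n"] by simp
  show "fold_plane m ` set is \<subseteq> {vec 1, vec (int m)}" if "is \<in> Q" for "is"
    using that Q image_mono[of "set is" plane_actions "fold_plane m"] fold_plane_actions[of m]
    unfolding paths_def by blast
  show "inj_on (\<lambda>e. (fold_plane m (fst e), fold_plane m (snd e))) (edges 0 Q)"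
    by (rule inj_on_fold_plane_edges[OF m n Q])
qed (rule \<Phi>)

theorem theorem5p1:
  fixes F :: "real measure"
    and M1 :: "nat \<Rightarrow> 'a measure"
    and g1 :: "nat \<Rightarrow> 'a \<Rightarrow> int ^ 1 \<Rightarrow> int ^ 1 \<Rightarrow> real"
    and M2 :: "'b measure"
    and g2 :: "'b \<Rightarrow> int ^ 2 \<Rightarrow> int ^ 2 \<Rightarrow> real"
  assumes "real_distribution F"
    and "bounded (measure_support F)"
    and "\<And>m. m \<ge> 1 \<Longrightarrow> pmdp {vec 1, vec (int m)} (M1 m) (g1 m)"
    and "\<And>m. m \<ge> 1 \<Longrightarrow> has_payoff_distribution {vec 1, vec (int m)} (M1 m) (g1 m) F"
    and "pmdp {axis 1 1, axis 2 1} M2 g2"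
    and "has_payoff_distribution {axis 1 1, axis 2 1} M2 g2 F"
  shows "(\<lambda>m. limit_value {vec 1, vec (int m)} (M1 m) (g1 m))
           \<longlonglongrightarrow> limit_value {axis 1 1, axis 2 1} M2 g2"
proof -
  obtain B where B: "0 \<le> B" and AE_F: "AE x in F. \<bar>x\<bar> \<le> B"
    using measure_support_AE_bounded[OF assms(1,2)] .
  let ?I1 = "\<lambda>m. {vec 1, vec (int m)} :: (int ^ 1) set"
  let ?v1 = "\<lambda>m. limit_value (?I1 m) (M1 m) (g1 m)"
  let ?v2 = "limit_value plane_actions M2 g2"
  \<comment> \<open>The height is the position itself on the line, with steps up to
    \<open>m\<close>, and the coordinate sum in the plane, with steps equal to 1.\<close>
  have walk1: "iid_walk (M1 m) (vec 1) (vec (int m)) (g1 m) F B (\<lambda>y. y $ 1) m" if "1 \<le> m" for m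
    by (rule pmdp_iid_walk) (use that assms B in auto)
  have walk2: "iid_walk M2 (axis 1 1) (axis 2 1) g2 F B (\<lambda>y. y $ 1 + y $ 2) 1"
    by (rule pmdp_iid_walk) (use assms B in \<open>auto simp: axis_def\<close>)
  have lim2: "mean_rate F B plane_actions \<longlonglongrightarrow> ?v2"
    by (rule limit_value_eq_mean_rate[OF walk2 AE_F])
  \<comment> \<open>The block length is \<open>m\<close>, the longest for which folding is known to
    separate edges. The rates of both models agree there, and the error constant
    \<open>2 * B\<^sup>2\<close> is free of \<open>m\<close>.\<close>
  have close: "\<bar>?v1 m - mean_rate F B plane_actions m\<bar> \<le> rate_error (2 * B\<^sup>2) m" if m: "2 \<le> m" for m
  proof -
    have w1: "iid_walk (M1 m) (vec 1) (vec (int m)) (g1 m) F B (\<lambda>y. y $ 1) m"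
      using walk1 m by simp
    note law = path_law_fold_plane[OF w1 m order_refl]
    have paths: "paths (?I1 m) m = map (fold_plane m) ` paths plane_actions m"
      using paths_map[of "fold_plane m" plane_actions m] by simp
    have "mean_rate F B (?I1 m) m = mean_rate F B plane_actions m"
      unfolding mean_rate_def paths using law[OF subset_refl, of "\<lambda>s. s"] by simp
    \<comment> \<open>The height on the line would give \<open>m * m\<close> ranks. Pulling the
      bridge back to the plane and ranking by coordinate sums gives \<open>m\<close> ranks, that is
      \<open>L = 1\<close>.\<close>
    moreover have "mgf_bound F B (1 * m) (bridges (?I1 m) m u)" if u: "u \<in> ends (?I1 m) m" for u
    proof -
      obtain u' where u': "u' \<in> ends plane_actions m"
        "bridges (?I1 m) m u = map (fold_plane m) ` bridges plane_actions m u'"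
        using bridges_fold_plane[OF m u] .
      have "mgf_bound F B (1 * m) (bridges plane_actions m u')"
        by (rule iid_walk.mgf_bound_phi[OF walk2 bridges_subset bridges_nonempty[OF u'(1)]])
      then show ?thesis
        unfolding mgf_bound_def u'(2) using law[OF bridges_subset] by simp
    qed
    from iid_walk.mean_rate_limit_close[OF w1 limit_value_eq_mean_rate[OF w1 AE_F] _ this]
    have "\<bar>?v1 m - mean_rate F B (?I1 m) m\<bar> \<le> rate_error (2 * B\<^sup>2) m"
      using m by simp
    ultimately show ?thesis by simp
  qed
  have "(\<lambda>m. ?v1 m - mean_rate F B plane_actions m) \<longlonglongrightarrow> 0"
  proof (rule Lim_null_comparison[OF _ rate_error_tendsto])
    show "eventually (\<lambda>m. norm (?v1 m - mean_rate F B plane_actions m) \<le> rate_error (2 * B\<^sup>2) m) sequentially"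
      using eventually_ge_at_top[of 2] by eventually_elim (use close in simp)
  qed
  from tendsto_add[OF this lim2] show ?thesis by simp
qed

end
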